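(* Let $p,q>0$ with $p+q=1$, and let $\mu_\star$, $\alpha(\cdot)$ and $\xi_\star:[0,1)\to\Omega_3$ be the measure and maps defined in the context (they are attached to the base $-\beta=-\frac{1+\sqrt5}{2}$). (i) If $p\ge q$, the measure $\mu_\star\circ\xi_\star^{-1}$ is weak Gibbs on $\Omega_3$. (ii) If $p\le q$, the measure $\mu_\star\circ S\circ\xi_\star^{-1}$ is weak Gibbs on $\Omega_3$, where $S(x)=1-x$ for any $x\in[0,1]$.
   Context: For an integer $r\ge 2$, $\Omega_r=\{0,1,\dots,r-1\}^{\mathbb N}$ is the set of sequences $\omega=(\omega_n)_{n\ge1}$ with the product topology, $\sigma$ is the shift $(\sigma\omega)_n=\omega_{n+1}$, and $[w_1\dots w_n]$ denotes the cylinder $\{\omega\in\Omega_r:\omega_i=w_i,\ 1\le i\le n\}$. Weak Gibbs: a probability measure $m$ on $\Omega_r$ is weak Gibbs if there is a continuous map $\phi:\Omega_r\to\mathbb R$ such that $$\lim_{n\to\infty}\left(\frac{m[\omega_1\dots\omega_n]}{e^{\phi(\omega)}e^{\phi(\sigma\omega)}\cdots e^{\phi(\sigma^{n-1}\omega)}}\right)^{1/n}=1\quad\text{uniformly on }\omega\in\Omega_r .$$ The measure $\mu_\star$: let $\beta=\frac{1+\sqrt5}{2}$. $\mu_\star$ is the distribution of the random variable $$Y(\omega)=\frac1\beta-\sum_{n\ge1}\frac{\omega_n}{(-\beta)^{n+1}},$$ where $\omega=(\omega_n)_{n\ge1}\in\Omega_2$ has the Bernoulli distribution with parameter vector $(p,q)$,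 i.e. the $\omega_n$ are i.i.d. with $P(\omega_n=0)=p$, $P(\omega_n=1)=q$. It is a probability measure carried by $[0,1]$. The expansion $\alpha(x)$: every $x\in[0,1)$ can be written in a unique way as $x=\frac1\beta-\sum_{n\ge1}\frac{\alpha_n}{(-\beta)^{n+1}}$ where $\alpha(x):=(\alpha_n)_{n\ge1}$ is a sequence with terms in $\{0,1\}$, without two consecutive terms $1$, and such that $\sigma^{2n+1}\alpha(x)$ differs from the periodic sequence $101010\dots$ for every $n\ge0$. The map $\xi_\star$: consider the words $w(0)=00$, $w(1)=010$, $w(2)=10$. For $x\in[0,1)$, $\xi_\star(x)=(\xi^\star_n)_{n\ge1}\in\Omega_3$ is the unique sequence such that, for every $n\ge1$, $\alpha(x)$ begins with the concatenated word $w(\xi^\star_1)w(\xi^\star_2)\cdots w(\xi^\star_n)$. The measure $\mu_\star\circ\xi_\star^{-1}$ is $E\mapsto\mu_\star(\xi_\star^{-1}(E))$, and $\mu_\star\circ S\circ\xi_\star^{-1}$ is $E\mapsto\mu_\star\big(S(\xi_\star^{-1}(E))\big)$, for Borel $E\subset\Omega_3$. *)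

theory Defs
  imports "HOL-Probability.Probability"
begin

text \<open>Sequences are indexed from 0: the \<open>n\<close>-th term (\<open>n \<ge> 1\<close>) of the usual notation is \<open>\<omega> (n - 1)\<close>.
  The type \<open>nat \<Rightarrow> nat\<close> carries the product of the discrete topologies, and \<open>Omega r\<close> is given the
  subspace topology, which is the product topology on \<open>{0, \<dots>, r - 1}\<close>-valued sequences.\<close>

definition Omega :: "nat \<Rightarrow> (nat \<Rightarrow> nat) set" where
  "Omega r = {\<omega>. \<forall>n. \<omega> n < r}"

definition borel_Omega :: "nat \<Rightarrow> (nat \<Rightarrow> nat) measure" where
  "borel_Omega r = restrict_space borel (Omega r)"

definition shift :: "(nat \<Rightarrow> nat) \<Rightarrow> nat \<Rightarrow> nat" where
  "shift \<omega> = (\<lambda>n. \<omega> (Suc n))"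

definition cylinder :: "nat \<Rightarrow> nat list \<Rightarrow> (nat \<Rightarrow> nat) set" where
  "cylinder r w = {\<omega> \<in> Omega r. \<forall>i < length w. \<omega> i = w ! i}"

definition weak_gibbs :: "nat \<Rightarrow> (nat \<Rightarrow> nat) measure \<Rightarrow> bool" where
  "weak_gibbs r m \<longleftrightarrow>
     prob_space m \<and> sets m = sets (borel_Omega r) \<and>
     (\<exists>\<phi> :: (nat \<Rightarrow> nat) \<Rightarrow> real. continuous_on (Omega r) \<phi> \<and>
       uniform_limit (Omega r)
         (\<lambda>n \<omega>. root n (measure m (cylinder r (map \<omega> [0..<n]))
                        / (\<Prod>k<n. exp (\<phi> ((shift ^^ k) \<omega>)))))
         (\<lambda>_. 1) sequentially)"

definition beta :: real where
  "beta = (1 + sqrt 5) / 2"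

text \<open>The exponent \<open>n + 2\<close> is due to the indexing from 0.\<close>

definition Y :: "(nat \<Rightarrow> nat) \<Rightarrow> real" where
  "Y \<omega> = 1 / beta - (\<Sum>n. real (\<omega> n) / (- beta) ^ (n + 2))"

text \<open>For \<open>p + q = 1\<close>, a probability measure whose underlying space is exactly \<open>Omega 2\<close>.\<close>

definition bernoulli_measure :: "real \<Rightarrow> real \<Rightarrow> (nat \<Rightarrow> nat) measure" where
  "bernoulli_measure p q =
     (\<Pi>\<^sub>M n\<in>UNIV. point_measure {0, 1} (\<lambda>d. ennreal (if d = 0 then p else q)))"

definition mu_star :: "real \<Rightarrow> real \<Rightarrow> real measure" where
  "mu_star p q = distr (bernoulli_measure p q) borel Y"

definition admissible :: "(nat \<Rightarrow> nat) \<Rightarrow> bool" where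
  "admissible a \<longleftrightarrow>
     a \<in> Omega 2 \<and>
     (\<forall>n. \<not> (a n = 1 \<and> a (Suc n) = 1)) \<and>
     (\<forall>n. (shift ^^ (2 * n + 1)) a \<noteq> (\<lambda>k. if even k then 1 else 0))"

text \<open>Meaningful for \<open>x \<in> {0..<1}\<close>, where the expansion exists and is unique; likewise for
  \<open>xi_star\<close> below.\<close>

definition alpha :: "real \<Rightarrow> nat \<Rightarrow> nat" where
  "alpha x = (THE a. admissible a \<and> x = Y a)"

definition code_word :: "nat \<Rightarrow> nat list" where
  "code_word d = (if d = 0 then [0, 0] else if d = 1 then [0, 1, 0] else [1, 0])"

definition begins_with :: "(nat \<Rightarrow> nat) \<Rightarrow> nat list \<Rightarrow> bool" where
  "begins_with a w \<longleftrightarrow> map a [0..<length w] = w"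

definition xi_star :: "real \<Rightarrow> nat \<Rightarrow> nat" where
  "xi_star x = (THE s. s \<in> Omega 3 \<and>
     (\<forall>n\<ge>1. begins_with (alpha x) (concat (map (\<lambda>k. code_word (s k)) [0..<n]))))"

text \<open>The preimage under \<open>xi_star\<close>, a map with domain \<open>{0..<1}\<close>.\<close>

definition xi_star_preimage :: "(nat \<Rightarrow> nat) set \<Rightarrow> real set" where
  "xi_star_preimage E = {x \<in> {0..<1}. xi_star x \<in> E}"

definition S :: "real \<Rightarrow> real" where
  "S x = 1 - x"

text \<open>By convention \<open>measure_of\<close> yields the null measure if the given set function is not a measure;
  this does not make \<open>weak_gibbs\<close> any easier, since it demands a probability measure.\<close>

definition mu_xi :: "real \<Rightarrow> real \<Rightarrow> (nat \<Rightarrow> nat) measure" where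
  "mu_xi p q = measure_of (Omega 3) (sets (borel_Omega 3))
     (\<lambda>E. emeasure (mu_star p q) (xi_star_preimage E))"

definition mu_S_xi :: "real \<Rightarrow> real \<Rightarrow> (nat \<Rightarrow> nat) measure" where
  "mu_S_xi p q = measure_of (Omega 3) (sets (borel_Omega 3))
     (\<lambda>E. emeasure (mu_star p q) (S ` xi_star_preimage E))"

end

theory Submission imports Defs begin

text \<open>
  Since \<open>Y\<close> satisfies \<open>Y \<omega> = 1 - Y (shift \<omega>) / \<beta>\<close> or \<open>Y \<omega> = (1 - Y (shift \<omega>)) / \<beta>\<close> according
  to the first digit, \<open>\<mu>\<close> is self-similar, and the preimage under \<open>\<xi>\<close> of a cylinder is an iterated
  image of the unit interval. Its mass together with the masses of two translates is a vector of
  dimension three, on which each code word acts as a matrix; up to scalar weights the matrices depend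
  on \<open>r = p / q\<close> only. The potential \<open>\<phi>\<close> is the limit of the logarithms of the growth factors of the
  total mass of the vector. It exists uniformly because the directions of the vectors converge
  uniformly: exponentially for \<open>r > 1\<close>, and at the rate \<open>1/n\<close> of Farey intervals for \<open>r = 1\<close>. The
  cylinder mass, the first entry, is within a factor \<open>2n + 3\<close> of the total mass. The second part
  follows from the first, since \<open>S\<close> exchanges \<open>p\<close> and \<open>q\<close>.
\<close>

section \<open>Products of the transfer matrices\<close>

text \<open>The branches map [0, 1] onto the overlapping intervals [2 - \<open>beta\<close>, 1] and
  [0, \<open>beta\<close> - 1], so the mass of a cylinder is not a product over its digits; the
  translated masses record the effect of the overlaps. \<open>step\<close> is the matrix of a code
  word with its weight divided out. These matrices have zero entries, and at r = 1 that of the digit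
  0 is unipotent, so uniform exponential contraction of directions fails there. The bound r >= 1
  keeps the first entry comparable with the total: for r < 1, once the second entry is 0, each
  further digit 2 multiplies the first entry by r while the third does not decrease, and the
  cylinder mass falls exponentially behind the total.\<close>

definition step :: "real \<Rightarrow> nat \<Rightarrow> real \<times> real \<times> real \<Rightarrow> real \<times> real \<times> real" where
  "step r d = (\<lambda>(a, b, e).
     if d = 0 then (r * a + b + e, b, e)
     else if d = 1 then (r * a + b, r * a + b + e, 0)
     else (r * a + b, 0, r * a + b + e))"

definition steps :: "real \<Rightarrow> nat list \<Rightarrow> real \<times> real \<times> real \<Rightarrow> real \<times> real \<times> real" where
  "steps r w = foldr (step r) w"

definition total :: "real \<times> real \<times> real \<Rightarrow> real" where
  "total = (\<lambda>(a, b, e). a + b + e)"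

definition nonneg3 :: "real \<times> real \<times> real \<Rightarrow> bool" where
  "nonneg3 = (\<lambda>(a, b, e). 0 \<le> a \<and> 0 \<le> b \<and> 0 \<le> e)"

text \<open>The l1 norm of the exterior product. It vanishes exactly when the vectors are parallel;
  divided by the product of the totals, it measures how far two directions are apart.\<close>

definition wedge :: "real \<times> real \<times> real \<Rightarrow> real \<times> real \<times> real \<Rightarrow> real" where
  "wedge = (\<lambda>(a, b, e) (a', b', e').
     \<bar>a * b' - a' * b\<bar> + \<bar>a * e' - a' * e\<bar> + \<bar>b * e' - b' * e\<bar>)"

lemma steps_simps [simp]:
  "steps r [] v = v" "steps r (d # w) v = step r d (steps r w v)"
  by (simp_all add: steps_def)

lemma steps_append: "steps r (u @ w) v = steps r u (steps r w v)"
  by (simp add: steps_def)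

lemma linear_step: "linear (step r d)"
  by (rule linearI) (auto simp: step_def algebra_simps)

lemma linear_steps: "linear (steps r w)"
proof (induction w)
  case Nil
  have "steps r [] = (\<lambda>v. v)" by (simp add: fun_eq_iff)
  then show ?case by (simp only: linear_ident)
next
  case (Cons d w)
  have "steps r (d # w) = step r d \<circ> steps r w" by (simp add: fun_eq_iff)
  then show ?case using linear_compose[OF Cons linear_step] by (simp only:)
qed

lemma linear_total: "linear total"
  by (rule linearI) (auto simp: total_def algebra_simps)

lemma steps_decompose:
  "steps r w (x, y, z) =
     x *\<^sub>R steps r w (1, 0, 0) + y *\<^sub>R steps r w (0, 1, 0) + z *\<^sub>R steps r w (0, 0, 1)"
proof -
  have "steps r w (x, y, z)
      = steps r w (x *\<^sub>R (1, 0, 0) + y *\<^sub>R (0, 1, 0) + z *\<^sub>R (0, 0, 1))"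
    by simp
  also have "\<dots> = x *\<^sub>R steps r w (1, 0, 0) + y *\<^sub>R steps r w (0, 1, 0) + z *\<^sub>R steps r w (0, 0, 1)"
    by (simp only: linear_add[OF linear_steps] linear_scale[OF linear_steps])
  finally show ?thesis .
qed

lemma nonneg3_step: "0 \<le> r \<Longrightarrow> nonneg3 v \<Longrightarrow> nonneg3 (step r d v)"
  by (auto simp: nonneg3_def step_def split: prod.splits)

lemma nonneg3_steps: "0 \<le> r \<Longrightarrow> nonneg3 v \<Longrightarrow> nonneg3 (steps r w v)"
  by (induction w) (auto intro: nonneg3_step)

lemma total_step_bounds:
  assumes "1 \<le> r" "nonneg3 v"
  shows "total v \<le> total (step r d v)" "total (step r d v) \<le> 2 * r * total v"
proof -
  obtain a b e where v: "v = (a, b, e)" by (cases v)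
  have nn: "0 \<le> a" "0 \<le> b" "0 \<le> e" using assms(2) by (auto simp: v nonneg3_def)
  then have "a \<le> r * a" "b \<le> r * b" "e \<le> r * e" using assms(1) by (simp_all add: mult_le_cancel_right1)
  then show "total v \<le> total (step r d v)" "total (step r d v) \<le> 2 * r * total v"
    using nn by (auto simp: v total_def step_def algebra_simps)
qed

lemma fst_step_ge:
  assumes "1 \<le> r" "nonneg3 v"
  shows "r * fst v \<le> fst (step r d v)"
  using assms by (auto simp: nonneg3_def step_def split: prod.splits)

lemma fst_steps_ge:
  assumes "1 \<le> r" "nonneg3 v"
  shows "r ^ length w * fst v \<le> fst (steps r w v)"
proof (induction w)
  case (Cons d w)
  have "r ^ length (d # w) * fst v = r * (r ^ length w * fst v)" by simp
  also have "\<dots> \<le> r * fst (steps r w v)" using Cons assms(1) by (intro mult_left_mono) auto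
  also have "\<dots> \<le> fst (steps r (d # w) v)"
    using fst_step_ge nonneg3_steps assms by simp
  finally show ?case .
qed simp

lemma total_steps_ge:
  assumes "1 \<le> r" "nonneg3 v"
  shows "total v \<le> total (steps r w v)"
proof (induction w)
  case (Cons d w)
  then show ?case
    using total_step_bounds(1)[OF assms(1) nonneg3_steps[of r v w], of d] assms by simp
qed simp

lemma fst_le_total: "nonneg3 v \<Longrightarrow> fst v \<le> total v"
  by (auto simp: nonneg3_def total_def)

section \<open>The first entry against the other two\<close>

definition dominated :: "real \<Rightarrow> real \<times> real \<times> real \<Rightarrow> bool" where
  "dominated K = (\<lambda>(a, b, e). b \<le> K * a \<and> e \<le> K * a)"

text \<open>The critical entry is r * a + b + e, created by the digits 1 and 2 next to the first
  entry r * a + b: bounding e by K * a leaves the condition r + K <= K' * r.\<close>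

lemma dominated_step:
  assumes "1 \<le> r" "nonneg3 v" "dominated K v" "0 \<le> K"
    and K': "1 \<le> K'" "r + K \<le> K' * r" "K \<le> K' * r"
  shows "dominated K' (step r d v)"
proof -
  obtain a b e where v: "v = (a, b, e)" by (cases v)
  have nn: "0 \<le> a" "0 \<le> b" "0 \<le> e" and le: "b \<le> K * a" "e \<le> K * a"
    using assms(2,3) by (auto simp: v nonneg3_def dominated_def)
  have 1: "(r + K) * a \<le> K' * r * a" "K * a \<le> K' * r * a"
    using K' nn by (auto intro!: mult_right_mono)
  have 2: "b \<le> K' * b" "0 \<le> K' * e" "0 \<le> K' * b" "0 \<le> K' * (r * a)" "0 \<le> K' * (b + e)"
    using K' nn assms(1) by (auto simp: mult_le_cancel_right1)
  show ?thesis
    using 1 2 le nn by (auto simp: v dominated_def step_def algebra_simps)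
qed

text \<open>One step enlarges the constant by at most 1, as r + K <= (K + 1) * r for r >= 1. The
  growth is linear, hence harmless after taking n-th roots.\<close>

lemma dominated_steps:
  assumes "1 \<le> r" "nonneg3 v" "dominated 1 v"
  shows "dominated (real (length w) + 1) (steps r w v)"
proof (induction w)
  case (Cons d w)
  have "r * (2 + real (length w)) \<ge> r + (1 + real (length w))"
    using assms(1) mult_right_mono[of 1 r "1 + real (length w)"] by (simp add: algebra_simps)
  moreover have "r * (2 + real (length w)) \<ge> (1 + real (length w))"
    using assms(1) mult_right_mono[of 1 r "2 + real (length w)"] by (simp add: algebra_simps)
  ultimately show ?case
    using dominated_step[OF assms(1) nonneg3_steps Cons, of "real (length w) + 2" d] assms
    by (simp add: algebra_simps)
qed (use assms in simp)

text \<open>The constant solves r + K = K * r, so \<open>dominated_step\<close> reproduces it, and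
  for r > 1 the bound is independent of the length of the word.\<close>

lemma dominated_steps_gt:
  assumes "1 < r" "nonneg3 v" "dominated (r / (r - 1)) v"
  shows "dominated (r / (r - 1)) (steps r w v)"
proof (induction w)
  case (Cons d w)
  have *: "r + r / (r - 1) = r / (r - 1) * r" "1 \<le> r / (r - 1)"
    using assms(1) by (simp_all add: field_simps)
  have "r / (r - 1) \<le> r / (r - 1) * r" using *(1) assms(1) by linarith
  then show ?case
    using dominated_step[of r "steps r w v" "r / (r - 1)" "r / (r - 1)" d] Cons assms * nonneg3_steps
    by simp
qed (use assms in simp)

lemma fst_ge_total:
  assumes "nonneg3 v" "dominated K v"
  shows "total v \<le> (1 + 2 * K) * fst v"
  using assms by (auto simp: total_def dominated_def algebra_simps)

text \<open>The condition says that the component \<open>b * e' - b' * e\<close> of the wedge product vanishes; the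
  other two components are then at most multiplied by \<open>r\<close>.\<close>

definition flat :: "real \<times> real \<times> real \<Rightarrow> real \<times> real \<times> real \<Rightarrow> bool" where
  "flat = (\<lambda>(a, b, e) (a', b', e'). b * e' = b' * e)"

lemma wedge_step:
  assumes "0 \<le> r" "flat u v"
  shows "flat (step r d u) (step r d v)" "wedge (step r d u) (step r d v) \<le> r * wedge u v"
proof -
  obtain a b e where u: "u = (a, b, e)" by (cases u)
  obtain a' b' e' where v: "v = (a', b', e')" by (cases v)
  have W: "b * e' = b' * e" using assms(2) by (simp add: u v flat_def)
  show "flat (step r d u) (step r d v)"
    using W by (simp add: u v flat_def step_def)
  consider (0) "d = 0" | (1) "d = 1" | (2) "d \<noteq> 0" "d \<noteq> 1" by blast
  then show "wedge (step r d u) (step r d v) \<le> r * wedge u v"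
  proof cases
    case 0
    have "(r * a + b + e) * b' - (r * a' + b' + e') * b = r * (a * b' - a' * b)"
      "(r * a + b + e) * e' - (r * a' + b' + e') * e = r * (a * e' - a' * e)"
      using W by algebra+
    then show ?thesis using 0 W assms(1)
      by (simp add: u v wedge_def step_def abs_mult distrib_left)
  next
    case 1
    have "(r * a + b) * (r * a' + b' + e') - (r * a' + b') * (r * a + b + e) = r * (a * e' - a' * e)"
      using W by algebra
    then show ?thesis using 1 W assms(1)
      by (simp add: u v wedge_def step_def abs_mult distrib_left)
  next
    case 2
    have "(r * a + b) * (r * a' + b' + e') - (r * a' + b') * (r * a + b + e) = r * (a * e' - a' * e)"
      using W by algebra
    then show ?thesis using 2 W assms(1)
      by (simp add: u v wedge_def step_def abs_mult distrib_left)
  qed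
qed

lemma wedge_steps:
  assumes "0 \<le> r" "flat u v"
  shows "flat (steps r w u) (steps r w v) \<and>
    wedge (steps r w u) (steps r w v) \<le> r ^ length w * wedge u v"
proof (induction w)
  case (Cons d w)
  then have "wedge (steps r (d # w) u) (steps r (d # w) v) \<le> r * wedge (steps r w u) (steps r w v)"
    using wedge_step assms(1) by simp
  also have "\<dots> \<le> r * (r ^ length w * wedge u v)"
    using Cons assms(1) by (intro mult_left_mono) auto
  finally show ?case using Cons wedge_step assms(1) by (simp add: mult.assoc)
qed (use assms in simp)

text \<open>The invariant behind the \<open>1/n\<close> rate at \<open>r = 1\<close>: as for the endpoints of Farey intervals, one
  of the two totals grows by at least \<open>1\<close> in each step while the wedge product stays bounded. The
  alternative with vanishing second entries turns into the other one under the digit \<open>1\<close>, after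
  which a further nonzero digit makes the vectors parallel.\<close>

definition spread :: "nat \<Rightarrow> real \<times> real \<times> real \<Rightarrow> real \<times> real \<times> real \<Rightarrow> bool" where
  "spread n u v \<longleftrightarrow> nonneg3 u \<and> nonneg3 v \<and>
     (wedge u v = 0 \<or>
      1 \<le> total u \<and> 1 \<le> total v \<and> real n + 2 \<le> total u + total v \<and>
      (fst (snd u) = 0 \<and> fst (snd v) = 0 \<and> 1 \<le> fst u \<and> 1 \<le> snd (snd v) \<or>
       snd (snd u) = 0 \<and> snd (snd v) = 0 \<and> 1 \<le> fst (snd v)))"

lemma spread_step:
  assumes "1 \<le> r" "spread n u v" "flat u v"
  shows "spread (Suc n) (step r d u) (step r d v)"
proof (cases "wedge u v = 0")
  case True
  have "0 \<le> wedge (step r d u) (step r d v)" by (auto simp: wedge_def split: prod.splits)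
  then have "wedge (step r d u) (step r d v) = 0"
    using wedge_step(2)[of r u v d] True assms by simp
  then show ?thesis using assms nonneg3_step by (simp add: spread_def)
next
  case False
  obtain a b e where u: "u = (a, b, e)" by (cases u)
  obtain a' b' e' where v: "v = (a', b', e')" by (cases v)
  have nn: "0 \<le> a" "0 \<le> b" "0 \<le> e" "0 \<le> a'" "0 \<le> b'" "0 \<le> e'"
    using assms by (auto simp: spread_def nonneg3_def u v)
  have ra: "a \<le> r * a" "a' \<le> r * a'" using nn assms(1) by (auto simp: mult_le_cancel_right1)
  \<comment> \<open>Naming the products makes the remaining inequalities linear.\<close>
  obtain s s' where s [simp]: "r * a = s" "r * a' = s'" by blast
  have tot: "1 \<le> a + b + e" "1 \<le> a' + b' + e'" "real n + 2 \<le> a + b + e + (a' + b' + e')"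
    using assms(2) False by (auto simp: spread_def total_def u v)
  have nn': "nonneg3 (step r d u)" "nonneg3 (step r d v)"
    using assms nonneg3_step by (auto simp: spread_def)
  \<comment> \<open>In case (E) the sum of the totals gains e' >= 1 under the digit 0 and a >= 1
    under the others; in case (B) it gains b' >= 1 under the digit 0, and the other digits make the
    vectors parallel.\<close>
  consider (E) "b = 0" "b' = 0" "1 \<le> a" "1 \<le> e'" | (B) "e = 0" "e' = 0" "1 \<le> b'"
    using assms(2) False by (auto simp: spread_def u v)
  then show ?thesis
  proof cases
    case E
    then show ?thesis using nn nn' ra tot
      by (auto simp: spread_def step_def u v total_def)
  next
    case B
    then show ?thesis using nn nn' ra tot
      by (auto simp: spread_def step_def u v total_def wedge_def)
  qed
qed

lemma spread_steps:
  assumes "1 \<le> r" "spread 0 u v" "flat u v"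
  shows "spread (length w) (steps r w u) (steps r w v)"
proof (induction w)
  case (Cons d w)
  then show ?case using spread_step[OF assms(1)] wedge_steps[of r u v w] assms by simp
qed (use assms in simp)

text \<open>At r = 1 the wedge stays at most 1, whereas two totals of at least 1 with sum at least n
  + 2 have product at least n + 1, because (t - 1) * (t' - 1) >= 0.\<close>

lemma wedge_le_product:
  assumes "spread 0 u v" "flat u v" "wedge u v \<le> 1"
  shows "(real (length w) + 1) * wedge (steps 1 w u) (steps 1 w v)
    \<le> total (steps 1 w u) * total (steps 1 w v)"
proof -
  define u' v' where "u' = steps 1 w u" and "v' = steps 1 w v"
  have s: "spread (length w) u' v'" using spread_steps[of 1] assms by (simp add: u'_def v'_def)
  have D: "wedge u' v' \<le> 1" using wedge_steps[of 1 u v w] assms by (simp add: u'_def v'_def)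
  show ?thesis
  proof (cases "wedge u' v' = 0")
    case True
    have "0 \<le> total u' * total v'"
      using s by (auto simp: spread_def nonneg3_def total_def intro!: mult_nonneg_nonneg)
    then show ?thesis using True by (simp add: u'_def v'_def)
  next
    case False
    then have t: "1 \<le> total u'" "1 \<le> total v'" "real (length w) + 2 \<le> total u' + total v'"
      using s by (auto simp: spread_def)
    have "0 \<le> (total u' - 1) * (total v' - 1)" using t by simp
    then have "real (length w) + 1 \<le> total u' * total v'" using t by (simp add: algebra_simps)
    moreover have "(real (length w) + 1) * wedge u' v' \<le> (real (length w) + 1) * 1"
      using D by (intro mult_left_mono) auto
    ultimately have "(real (length w) + 1) * wedge u' v' \<le> total u' * total v'"
      by (simp only: mult_1_right)
    then show ?thesis by (simp only: u'_def v'_def)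
  qed
qed

text \<open>Bilinearity: the multiple of A drops out because A is parallel to itself.\<close>

lemma wedge_combination:
  assumes "0 \<le> y" "0 \<le> z"
  shows "wedge A (x *\<^sub>R A + y *\<^sub>R B + z *\<^sub>R E) \<le> y * wedge A B + z * wedge A E"
proof -
  obtain a1 a2 a3 where A: "A = (a1, a2, a3)" by (cases A)
  obtain b1 b2 b3 where B: "B = (b1, b2, b3)" by (cases B)
  obtain e1 e2 e3 where E: "E = (e1, e2, e3)" by (cases E)
  have 2: "\<bar>y * s + z * t\<bar> \<le> y * \<bar>s\<bar> + z * \<bar>t\<bar>" for s t :: real
    using abs_triangle_ineq[of "y * s" "z * t"] assms by (simp add: abs_mult)
  show ?thesis
proof -
    have 1: "a1 * (x * a2 + y * b2 + z * e2) - (x * a1 + y * b1 + z * e1) * a2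
        = y * (a1 * b2 - b1 * a2) + z * (a1 * e2 - e1 * a2)"
      "a1 * (x * a3 + y * b3 + z * e3) - (x * a1 + y * b1 + z * e1) * a3
        = y * (a1 * b3 - b1 * a3) + z * (a1 * e3 - e1 * a3)"
      "a2 * (x * a3 + y * b3 + z * e3) - (x * a2 + y * b2 + z * e2) * a3
        = y * (a2 * b3 - b2 * a3) + z * (a2 * e3 - e2 * a3)"
      by algebra+
    have "wedge A (x *\<^sub>R A + y *\<^sub>R B + z *\<^sub>R E) =
        \<bar>y * (a1 * b2 - b1 * a2) + z * (a1 * e2 - e1 * a2)\<bar>
        + \<bar>y * (a1 * b3 - b1 * a3) + z * (a1 * e3 - e1 * a3)\<bar>
        + \<bar>y * (a2 * b3 - b2 * a3) + z * (a2 * e3 - e2 * a3)\<bar>"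
      by (simp only: A B E wedge_def 1[symmetric] scaleR_Pair add_Pair
          prod.case real_scaleR_def)
    then show ?thesis
      using 2[of "a1 * b2 - b1 * a2" "a1 * e2 - e1 * a2"] 2[of "a1 * b3 - b1 * a3" "a1 * e3 - e1 * a3"]
        2[of "a2 * b3 - b2 * a3" "a2 * e3 - e2 * a3"]
      by (simp only: A B E wedge_def prod.case distrib_left)
  qed
qed

definition modulus :: "real \<Rightarrow> nat \<Rightarrow> real" where
  "modulus r n = (if r = 1 then 2 / (real n + 1) else 2 * (r / (r - 1)) / r ^ n)"

lemma modulus_tendsto: "1 \<le> r \<Longrightarrow> modulus r \<longlonglongrightarrow> 0"
proof (cases "r = 1")
  case True
  have "(\<lambda>n. 2 / (real n + 1)) \<longlonglongrightarrow> 0" by real_asymp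
  then show ?thesis using True by (simp add: modulus_def[abs_def])
next
  case False
  assume "1 \<le> r"
  then have "(\<lambda>n. inverse r ^ n) \<longlonglongrightarrow> 0"
    using False by (intro LIMSEQ_realpow_zero) (auto simp: field_simps)
  then have "(\<lambda>n. 2 * (r / (r - 1)) * inverse r ^ n) \<longlonglongrightarrow> 0"
    by (rule tendsto_mult_right_zero)
  then show ?thesis using False
    by (simp add: modulus_def[abs_def] divide_inverse power_inverse)
qed

text \<open>The vector (1, 0, 0) serves as reference because its pairs with the other two basis
  vectors are \<open>flat\<close>, whereas the pair of those two is not. For r = 1 both pairs obey
  \<open>wedge_le_product\<close>; for r > 1 the wedge grows at most like r^n, but each of the two
  totals at least like r^n.\<close>

lemma wedge_le_modulus:
  assumes r: "1 \<le> r" and v: "nonneg3 v" "0 < fst v" "r \<noteq> 1 \<Longrightarrow> dominated (r / (r - 1)) v"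
  shows "wedge (steps r w (1, 0, 0)) (steps r w v)
    \<le> modulus r (length w) * (total (steps r w (1, 0, 0)) * total (steps r w v))"
proof -
  obtain x y z where xyz: "v = (x, y, z)" by (cases v)
  have nn: "0 < x" "0 \<le> y" "0 \<le> z" using v by (auto simp: xyz nonneg3_def)
  define A B E where "A = steps r w (1, 0, 0)" and "B = steps r w (0, 1, 0)"
    and "E = steps r w (0, 0, 1)"
  let ?V = "steps r w v"
  have V: "?V = x *\<^sub>R A + y *\<^sub>R B + z *\<^sub>R E"
    unfolding xyz A_def B_def E_def by (rule steps_decompose)
  have D: "wedge A ?V \<le> y * wedge A B + z * wedge A E"
    unfolding V using nn by (intro wedge_combination) auto
  have tV: "total ?V = x * total A + y * total B + z * total E"
    unfolding V by (simp add: linear_add[OF linear_total] linear_scale[OF linear_total])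
  have nnA: "nonneg3 A" using nonneg3_steps r by (simp add: A_def nonneg3_def)
  have totA: "1 \<le> total A"
    using total_steps_ge[OF r, of "(1,0,0)" w] by (simp add: A_def nonneg3_def total_def)
  show ?thesis
  proof (cases "r = 1")
    case True
    let ?n = "real (length w) + 1"
    have 1: "?n * wedge A B \<le> total A * total B" "?n * wedge A E \<le> total A * total E"
      unfolding A_def B_def E_def True
      by (rule wedge_le_product; simp add: spread_def nonneg3_def total_def flat_def wedge_def)+
    have "?n * wedge A ?V \<le> ?n * (y * wedge A B + z * wedge A E)"
      using D by (intro mult_left_mono) auto
    also have "\<dots> = y * (?n * wedge A B) + z * (?n * wedge A E)" by (simp add: algebra_simps)
    also have "\<dots> \<le> y * (total A * total B) + z * (total A * total E)"
      using 1 nn by (intro add_mono mult_left_mono) auto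
    also have "\<dots> \<le> total A * total ?V"
      using nn totA by (simp add: tV algebra_simps)
    also have "\<dots> \<le> 2 * (total A * total ?V)"
      using total_steps_ge[OF r v(1), of w] fst_le_total[OF v(1)] v(2) totA by simp
    finally show ?thesis using True
      by (simp add: modulus_def field_simps A_def)
  next
    case False
    define K where "K = r / (r - 1)"
    have K: "0 \<le> K" "y \<le> K * x" "z \<le> K * x"
      using v(3) False r by (auto simp: K_def dominated_def xyz)
    let ?R = "r ^ length w"
    have R: "0 < ?R" using r by simp
    have 1: "wedge A B \<le> ?R" "wedge A E \<le> ?R"
      using wedge_steps[of r "(1,0,0)" "(0,1,0)" w] wedge_steps[of r "(1,0,0)" "(0,0,1)" w] r
      by (auto simp: flat_def wedge_def A_def B_def E_def)
    have 2: "?R \<le> total A" "?R * x \<le> total ?V"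
    proof -
      show "?R \<le> total A"
        using fst_steps_ge[OF r, of "(1,0,0)" w] fst_le_total[OF nnA]
        by (simp add: nonneg3_def A_def)
      show "?R * x \<le> total ?V"
        using fst_steps_ge[OF r v(1), of w] fst_le_total[OF nonneg3_steps[of r v w]] r v(1)
        by (simp add: xyz)
    qed
    have "wedge A ?V \<le> y * ?R + z * ?R"
      using D 1 nn by (smt (verit) mult_left_mono)
    \<comment> \<open>The lower bound for the total of \<open>?V\<close> involves x only, so y and z
      are traded for multiples of x by \<open>dominated\<close>.\<close>
    also have "\<dots> \<le> K * x * ?R + K * x * ?R"
      using K R by (intro add_mono mult_right_mono) auto
    also have "\<dots> = 2 * K / ?R * (?R * (?R * x))" using R by (simp add: field_simps)
    also have "\<dots> \<le> 2 * K / ?R * (total A * total ?V)"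
      using 2 K R nn by (intro mult_left_mono mult_mono) auto
    finally show ?thesis using False by (simp add: modulus_def A_def K_def)
  qed
qed

section \<open>Uniform limits and weak Gibbs measures\<close>

definition ratio :: "real \<Rightarrow> nat \<Rightarrow> real \<times> real \<times> real \<Rightarrow> real" where
  "ratio r d v = total (step r d v) / total v"

lemma ratio_bounds:
  assumes "1 \<le> r" "nonneg3 v" "0 < total v"
  shows "1 \<le> ratio r d v" "ratio r d v \<le> 2 * r"
  using total_step_bounds[OF assms(1,2), of d] assms(3)
  by (simp_all add: ratio_def le_divide_eq divide_le_eq)

text \<open>After clearing denominators the difference is bilinear and antisymmetric in u and v,
  hence a combination of their 2 x 2 minors, with coefficients of modulus at most 2 * r.\<close>

lemma ratio_diff:
  assumes r: "1 \<le> r" and u: "0 < total u" and v: "0 < total v"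
  shows "\<bar>ratio r d u - ratio r d v\<bar> \<le> 2 * r * (wedge u v / (total u * total v))"
proof -
  obtain a b e where ue: "u = (a, b, e)" by (cases u)
  obtain a' b' e' where ve: "v = (a', b', e')" by (cases v)
  define P Q W where "P = a * b' - a' * b" and "Q = a * e' - a' * e" and "W = b * e' - b' * e"
  have D: "wedge u v = \<bar>P\<bar> + \<bar>Q\<bar> + \<bar>W\<bar>" by (simp add: ue ve wedge_def P_def Q_def W_def)
  have "\<bar>total (step r d u) * total v - total (step r d v) * total u\<bar> \<le> 2 * r * wedge u v"
  proof (cases "d = 0")
    case True
    have "total (step r d u) * total v - total (step r d v) * total u = (r - 2) * (P + Q)"
      using True by (simp add: ue ve total_def step_def P_def Q_def algebra_simps)
    moreover have "\<bar>(r - 2) * (P + Q)\<bar> \<le> (2 * r) * (\<bar>P\<bar> + \<bar>Q\<bar>)"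
      unfolding abs_mult using r by (intro mult_mono) auto
    ultimately have "\<bar>total (step r d u) * total v - total (step r d v) * total u\<bar>
        \<le> (2 * r) * (\<bar>P\<bar> + \<bar>Q\<bar>)" by (simp only:)
    also have "\<dots> \<le> (2 * r) * wedge u v" using D r by (intro mult_left_mono) auto
    finally show ?thesis .
  next
    case False
    have "total (step r d u) * total v - total (step r d v) * total u
        = (2 * r - 2) * P + (2 * r - 1) * Q + W"
      using False by (simp add: ue ve total_def step_def P_def Q_def W_def algebra_simps)
    moreover have "\<bar>(2 * r - 2) * P + (2 * r - 1) * Q + W\<bar>
        \<le> (2 * r) * \<bar>P\<bar> + (2 * r) * \<bar>Q\<bar> + (2 * r) * \<bar>W\<bar>"
    proof -
      have "\<bar>(2 * r - 2) * P\<bar> \<le> (2 * r) * \<bar>P\<bar>" "\<bar>(2 * r - 1) * Q\<bar> \<le> (2 * r) * \<bar>Q\<bar>"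
        unfolding abs_mult using r by (intro mult_right_mono; simp)+
      moreover have "1 * \<bar>W\<bar> \<le> (2 * r) * \<bar>W\<bar>" using r by (intro mult_right_mono) auto
      ultimately show ?thesis by linarith
    qed
    ultimately show ?thesis unfolding D by (simp only: distrib_left)
  qed
  moreover have "ratio r d u - ratio r d v
      = (total (step r d u) * total v - total (step r d v) * total u) / (total u * total v)"
    using u v by (simp add: ratio_def field_simps)
  ultimately show ?thesis using u v
    by (simp add: abs_mult divide_right_mono)
qed

lemma abs_ln_diff_le:
  fixes x y :: real
  assumes "1 \<le> x" "1 \<le> y"
  shows "\<bar>ln x - ln y\<bar> \<le> \<bar>x - y\<bar>"
proof -
  have *: "ln s - ln t \<le> s - t" if "1 \<le> t" "t \<le> s" for s t :: real
  proof -
    have "ln s - ln t = ln (s / t)" using that by (simp add: ln_div)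
    also have "\<dots> \<le> s / t - 1" using that by (intro ln_le_minus_one) auto
    also have "\<dots> = (s - t) / t" using that by (simp add: field_simps)
    also have "\<dots> \<le> s - t" using that by (simp add: divide_le_eq mult_le_cancel_left1)
    finally show ?thesis .
  qed
  have "ln t \<le> ln s" if "1 \<le> t" "t \<le> s" for s t :: real using that by simp
  then show ?thesis using *[of y x] *[of x y] assms by (smt (verit))
qed

lemma shift_funpow: "(shift ^^ k) \<omega> n = \<omega> (n + k)"
  by (induction k arbitrary: n) (simp_all add: shift_def)

lemma shift_Omega: "\<omega> \<in> Omega r \<Longrightarrow> (shift ^^ k) \<omega> \<in> Omega r"
  by (simp add: Omega_def shift_funpow)

text \<open>Such a function is locally constant, since prescribing finitely many discrete
  coordinates is an open condition.\<close>

lemma continuous_on_finite_memory: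
  fixes f :: "(nat \<Rightarrow> nat) \<Rightarrow> 'a :: topological_space"
  assumes "\<And>\<omega> \<omega>'. (\<And>i. i < N \<Longrightarrow> \<omega> i = \<omega>' i) \<Longrightarrow> f \<omega> = f \<omega>'"
  shows "continuous_on A f"
  unfolding continuous_on_topological
proof (intro ballI allI impI)
  fix x B assume "x \<in> A" "open B" "f x \<in> B"
  let ?U = "\<Inter>i\<in>{..<N}. (\<lambda>\<omega>. \<omega> i) -` {x i}"
  have "open ((\<lambda>\<omega>. \<omega> i) -` {x i})" for i
    by (rule open_vimage[OF Topological_Spaces.open_discrete continuous_on_product_coordinates])
  then have "open ?U" by (intro open_INT) auto
  moreover have "f y \<in> B" if "y \<in> ?U" for y
    using that assms[of y x] \<open>f x \<in> B\<close> by auto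
  ultimately show "\<exists>U. open U \<and> x \<in> U \<and> (\<forall>y\<in>A. y \<in> U \<longrightarrow> f y \<in> B)" by (intro exI[of _ ?U]) auto
qed

text \<open>A Cesaro mean in which the order of approximation drops as the point is shifted: at most
  N of the n terms have order below N, each of modulus at most 2 * C, and all others are below e /
  2.\<close>

lemma uniform_limit_cesaro:
  fixes f :: "nat \<Rightarrow> (nat \<Rightarrow> nat) \<Rightarrow> real"
  assumes lim: "uniform_limit (Omega r) f \<phi> sequentially"
    and bdd: "\<And>n \<omega>. \<omega> \<in> Omega r \<Longrightarrow> \<bar>f n \<omega>\<bar> \<le> C"
  shows "uniform_limit (Omega r)
    (\<lambda>n \<omega>. (\<Sum>k<n. f (n - Suc k) ((shift ^^ k) \<omega>) - \<phi> ((shift ^^ k) \<omega>)) / n) (\<lambda>_. 0) sequentially"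
proof (rule uniform_limitI)
  fix e :: real assume e: "0 < e"
  obtain N where N: "\<And>n \<omega>. n \<ge> N \<Longrightarrow> \<omega> \<in> Omega r \<Longrightarrow> \<bar>f n \<omega> - \<phi> \<omega>\<bar> < e / 2"
    using uniform_limitD[OF lim, of "e/2"] e
    by (auto simp: eventually_sequentially dist_real_def)
  have \<phi>: "\<bar>\<phi> \<omega>\<bar> \<le> C" if "\<omega> \<in> Omega r" for \<omega>
    using tendsto_rabs[OF tendsto_uniform_limitI[OF lim that]] bdd[OF that]
    by (intro LIMSEQ_le_const2) auto
  have "(\<lambda>n. 2 * C * N / real n) \<longlonglongrightarrow> 0" by (rule lim_const_over_n)
  then have "eventually (\<lambda>n. 2 * C * N / real n < e / 2) sequentially"
    using e by (intro order_tendstoD(2)) auto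
  then show "\<forall>\<^sub>F n in sequentially. \<forall>\<omega>\<in>Omega r.
      dist ((\<Sum>k<n. f (n - Suc k) ((shift ^^ k) \<omega>) - \<phi> ((shift ^^ k) \<omega>)) / n) 0 < e"
    using eventually_gt_at_top[of 0]
  proof eventually_elim
    case (elim n)
    show ?case
    proof
      fix \<omega> assume \<omega>: "\<omega> \<in> Omega r"
      let ?t = "\<lambda>k. f (n - Suc k) ((shift ^^ k) \<omega>) - \<phi> ((shift ^^ k) \<omega>)"
      have t: "\<bar>?t k\<bar> \<le> e / 2 + (if n - Suc k < N then 2 * C else 0)" for k
        using N[of "n - Suc k", OF _ shift_Omega[OF \<omega>, of k]] bdd[OF shift_Omega[OF \<omega>, of k], of "n - Suc k"]
          \<phi>[OF shift_Omega[OF \<omega>, of k]] e by (smt (verit) field_sum_of_halves not_le)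
      have C: "0 \<le> C" using \<phi>[OF \<omega>] by linarith
      have "\<bar>\<Sum>k<n. ?t k\<bar> \<le> (\<Sum>k<n. e / 2 + (if n - Suc k < N then 2 * C else 0))"
        using t by (intro order_trans[OF sum_abs] sum_mono) auto
      also have "\<dots> = n * (e / 2) + (\<Sum>k<n. if n - Suc k < N then 2 * C else 0)"
        by (simp add: sum.distrib)
      also have "(\<Sum>k<n. if n - Suc k < N then 2 * C else 0) = (\<Sum>k<n. if k < N then 2 * C else 0)"
        by (rule sum.nat_diff_reindex)
      also have "\<dots> = (\<Sum>k\<in>{..<n} \<inter> {..<N}. 2 * C)"
        by (subst sum.inter_restrict) auto
      also have "\<dots> \<le> 2 * C * N"
      proof -
        have "card ({..<n} \<inter> {..<N}) \<le> card {..<N}" by (intro card_mono) auto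
        then have "2 * C * real (card ({..<n} \<inter> {..<N})) \<le> 2 * C * real N"
          using C by (intro mult_left_mono) auto
        then show ?thesis by (simp add: mult.commute)
      qed
      finally have "\<bar>\<Sum>k<n. ?t k\<bar> / n \<le> (n * (e / 2) + 2 * C * N) / n"
        by (intro divide_right_mono) auto
      also have "\<dots> = e / 2 + 2 * C * N / n" using elim by (simp add: field_simps)
      also have "\<dots> < e" using elim by linarith
      finally show "dist ((\<Sum>k<n. ?t k) / n) 0 < e" by (simp add: dist_real_def)
    qed
  qed
qed

text \<open>The potential itself is a limit; a cylinder of length n determines only the
  approximation of order n - Suc k at its k-th digit. Replacing f by \<phi> is paid for by the
  Cesaro argument, and the error b n disappears in the n-th root.\<close>

lemma weak_gibbsI:
  fixes f :: "nat \<Rightarrow> (nat \<Rightarrow> nat) \<Rightarrow> real"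
  assumes m: "prob_space m" "sets m = sets (borel_Omega r)"
    and cont: "\<And>n. continuous_on (Omega r) (f n)"
    and lim: "uniform_limit (Omega r) f \<phi> sequentially"
    and bdd: "\<And>n \<omega>. \<omega> \<in> Omega r \<Longrightarrow> \<bar>f n \<omega>\<bar> \<le> C"
    and b: "(\<lambda>n. b n / real n) \<longlonglongrightarrow> 0"
    and pos: "\<And>n \<omega>. \<omega> \<in> Omega r \<Longrightarrow> 0 < measure m (cylinder r (map \<omega> [0..<n]))"
    and est: "\<And>n \<omega>. \<omega> \<in> Omega r \<Longrightarrow>
      \<bar>ln (measure m (cylinder r (map \<omega> [0..<n]))) - (\<Sum>k<n. f (n - Suc k) ((shift ^^ k) \<omega>))\<bar> \<le> b n"
  shows "weak_gibbs r m"
proof -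
  let ?m = "\<lambda>n \<omega>. measure m (cylinder r (map \<omega> [0..<n]))"
  let ?P = "\<lambda>n \<omega>. \<Prod>k<n. exp (\<phi> ((shift ^^ k) \<omega>))"
  let ?s = "\<lambda>n \<omega>. (\<Sum>k<n. f (n - Suc k) ((shift ^^ k) \<omega>) - \<phi> ((shift ^^ k) \<omega>)) / n"
  let ?l = "\<lambda>n \<omega>. ln (?m n \<omega> / ?P n \<omega>) / n"
  have "uniform_limit (Omega r) ?l (\<lambda>_. 0) sequentially"
  proof (rule uniform_limitI)
    fix e :: real assume e: "0 < e"
    have "\<forall>\<^sub>F n in sequentially. \<forall>\<omega>\<in>Omega r. dist (?s n \<omega>) 0 < e / 2"
      using uniform_limitD[OF uniform_limit_cesaro[OF lim bdd], of "e / 2"] e by simp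
    moreover have "\<forall>\<^sub>F n in sequentially. b n / real n < e / 2"
      using order_tendstoD(2)[OF b, of "e / 2"] e by simp
    ultimately show "\<forall>\<^sub>F n in sequentially. \<forall>\<omega>\<in>Omega r. dist (?l n \<omega>) 0 < e"
    proof eventually_elim
      case (elim n)
      show ?case
      proof
        fix \<omega> assume \<omega>: "\<omega> \<in> Omega r"
        have lnP: "ln (?P n \<omega>) = (\<Sum>k<n. \<phi> ((shift ^^ k) \<omega>))" by (subst ln_prod) auto
        have "0 < ?P n \<omega>" by (intro prod_pos) auto
        then have "ln (?m n \<omega> / ?P n \<omega>) = ln (?m n \<omega>) - (\<Sum>k<n. \<phi> ((shift ^^ k) \<omega>))"
          using pos[OF \<omega>, of n] lnP by (simp add: ln_div)
        then have eq: "?l n \<omega> = (ln (?m n \<omega>) - (\<Sum>k<n. f (n - Suc k) ((shift ^^ k) \<omega>))) / n + ?s n \<omega>"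
          by (simp add: sum_subtractf add_divide_distrib[symmetric])
        have "\<bar>(ln (?m n \<omega>) - (\<Sum>k<n. f (n - Suc k) ((shift ^^ k) \<omega>))) / n\<bar> \<le> b n / n"
          using est[OF \<omega>, of n] by (simp add: divide_right_mono)
        moreover have "\<bar>?s n \<omega>\<bar> < e / 2" using elim(1) \<omega> by (auto simp: dist_real_def)
        ultimately have "\<bar>?l n \<omega>\<bar> < e" using elim(2) eq by linarith
        then show "dist (?l n \<omega>) 0 < e" by (simp add: dist_real_def)
      qed
    qed
  qed
  then have l: "uniform_limit (Omega r) ?l (\<lambda>_. 0) sequentially" .
  have "uniform_limit (Omega r) (\<lambda>n \<omega>. root n (?m n \<omega> / ?P n \<omega>)) (\<lambda>_. 1) sequentially"
  proof (rule uniform_limitI)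
    fix e :: real assume e: "0 < e"
    have "isCont exp (0::real)" by simp
    then obtain d where d: "0 < d" "\<And>x::real. \<bar>x\<bar> < d \<Longrightarrow> \<bar>exp x - 1\<bar> < e"
      using e by (auto simp: continuous_at_eps_delta dist_real_def)
    show "\<forall>\<^sub>F n in sequentially. \<forall>\<omega>\<in>Omega r. dist (root n (?m n \<omega> / ?P n \<omega>)) 1 < e"
      using uniform_limitD[OF l d(1)] eventually_gt_at_top[of 0]
    proof eventually_elim
      case (elim n)
      show ?case
      proof
        fix \<omega> assume \<omega>: "\<omega> \<in> Omega r"
        have "0 < ?P n \<omega>" by (intro prod_pos) auto
        then have q: "0 < ?m n \<omega> / ?P n \<omega>" using pos[OF \<omega>, of n] by simp
        \<comment> \<open>Writing the root as an exponential requires n > 0, since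
          \<open>root 0\<close> is constantly 0.\<close>
        then have "root n (?m n \<omega> / ?P n \<omega>) = exp (?l n \<omega>)"
          using elim(2) by (subst ln_root[symmetric]) (simp_all add: real_root_gt_zero)
        moreover have "\<bar>?l n \<omega>\<bar> < d" using elim(1) \<omega> by (auto simp: dist_real_def)
        ultimately show "dist (root n (?m n \<omega> / ?P n \<omega>)) 1 < e"
          using d(2) by (simp add: dist_real_def)
      qed
    qed
  qed
  moreover have "continuous_on (Omega r) \<phi>"
    using cont by (intro uniform_limit_theorem[OF always_eventually lim]) simp_all
  ultimately have "continuous_on (Omega r) \<phi> \<and>
      uniform_limit (Omega r) (\<lambda>n \<omega>. root n (?m n \<omega> / ?P n \<omega>)) (\<lambda>_. 1) sequentially" by (rule conjI[rotated])
  then show ?thesis unfolding weak_gibbs_def using m by blast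
qed

section \<open>The potential of a product of transfer matrices\<close>

lemma ratio_diff_modulus:
  assumes r: "1 \<le> r" and v: "nonneg3 v" "0 < fst v" "r \<noteq> 1 \<Longrightarrow> dominated (r / (r - 1)) v"
  shows "\<bar>ratio r d (steps r w (1, 0, 0)) - ratio r d (steps r w v)\<bar> \<le> 2 * r * modulus r (length w)"
proof -
  let ?A = "steps r w (1, 0, 0)" and ?V = "steps r w v"
  have A: "0 < total ?A"
    using total_steps_ge[OF r, of "(1, 0, 0)" w] by (simp add: nonneg3_def total_def)
  have V: "0 < total ?V"
    using total_steps_ge[OF r v(1), of w] fst_le_total[OF v(1)] v(2) by simp
  have "wedge ?A ?V / (total ?A * total ?V) \<le> modulus r (length w)"
    using wedge_le_modulus[OF assms, of w] A V by (simp add: pos_divide_le_eq)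
  then have "2 * r * (wedge ?A ?V / (total ?A * total ?V)) \<le> 2 * r * modulus r (length w)"
    using r by (intro mult_left_mono) auto
  then show ?thesis using ratio_diff[OF r A V, of d] by linarith
qed

text \<open>Appending w' merely replaces the start vector v by \<open>steps r w' v\<close>, which
  still satisfies the hypotheses of \<open>ratio_diff_modulus\<close>. Both directions are compared
  with the reference vector, whence 4 * r = 2 * r + 2 * r. The bound is free of w', which gives the
  Cauchy property.\<close>

lemma ratio_diff_extension:
  assumes r: "1 \<le> r" and v: "nonneg3 v" "0 < fst v" "dominated 1 v"
  shows "\<bar>ratio r d (steps r w v) - ratio r d (steps r (w @ w') v)\<bar> \<le> 4 * r * modulus r (length w)"
proof -
  have dom: "dominated (r / (r - 1)) v" if "r \<noteq> 1"
  proof -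
    have "1 \<le> r / (r - 1)" using r that by simp
    then have "1 * fst v \<le> r / (r - 1) * fst v" using v by (intro mult_right_mono) auto
    then show ?thesis using v(3) by (auto simp: dominated_def)
  qed
  have 1: "\<bar>ratio r d (steps r w (1, 0, 0)) - ratio r d (steps r w v)\<bar> \<le> 2 * r * modulus r (length w)"
    using ratio_diff_modulus[OF r v(1,2) dom] by blast
  have "0 < r ^ length w' * fst v" using r v by simp
  then have "0 < fst (steps r w' v)" using fst_steps_ge[OF r v(1), of w'] by linarith
  then have "\<bar>ratio r d (steps r w (1, 0, 0)) - ratio r d (steps r w (steps r w' v))\<bar>
      \<le> 2 * r * modulus r (length w)"
    using r v by (intro ratio_diff_modulus nonneg3_steps dominated_steps_gt dom) auto
  then show ?thesis using 1 by (simp add: steps_append)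
qed

text \<open>The first digit of a word acts last, so removing it divides the total by one growth
  factor, determined by that digit and the direction of the remaining product. The total telescopes
  into these factors, whose logarithms are the functions f.\<close>

lemma weak_gibbs_steps:
  fixes c :: "nat \<Rightarrow> real"
  assumes m: "prob_space m" "sets m = sets (borel_Omega s)"
    and r: "1 \<le> r" and c: "\<And>d. 0 < c d"
    and v: "nonneg3 v" "fst v = 1" "dominated 1 v"
    and meas: "\<And>\<omega> n. \<omega> \<in> Omega s \<Longrightarrow> measure m (cylinder s (map \<omega> [0..<n]))
      = (\<Prod>k<n. c (\<omega> k)) * fst (steps r (map \<omega> [0..<n]) v)"
  shows "weak_gibbs s m"
proof -
  define V where "V n \<omega> = steps r (map \<omega> [0..<n]) v" for n \<omega>
  define f where "f n \<omega> = ln (c (\<omega> 0) * ratio r (\<omega> 0) (V n (shift \<omega>)))" for n \<omega>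
  have upt: "map \<omega> [0..<Suc n] = \<omega> 0 # map (shift \<omega>) [0..<n]" for \<omega> :: "nat \<Rightarrow> nat" and n
    by (simp add: map_upt_Suc shift_def del: upt_Suc)
  have V_Suc: "V (Suc n) \<omega> = step r (\<omega> 0) (V n (shift \<omega>))" for n \<omega>
    unfolding V_def upt by simp
  have nnV: "nonneg3 (V n \<omega>)" for n \<omega> using nonneg3_steps r v by (simp add: V_def)
  have totv: "1 \<le> total v" "total v \<le> 3"
    using v by (auto simp: total_def nonneg3_def dominated_def)
  have totV: "1 \<le> total (V n \<omega>)" for n \<omega>
    using total_steps_ge[OF r v(1), of "map \<omega> [0..<n]"] totv by (simp add: V_def)
  have fstV: "1 \<le> fst (V n \<omega>)" for n \<omega>
    using fst_steps_ge[OF r v(1), of "map \<omega> [0..<n]"] v(2) one_le_power[OF r, of n]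
    by (simp add: V_def)
  have ratio_bds: "1 \<le> ratio r d (V n \<omega>)" "ratio r d (V n \<omega>) \<le> 2 * r" for d n \<omega>
    using ratio_bounds[OF r nnV, of n \<omega> d] totV[of n \<omega>] by simp_all
  have f_eq: "f n \<omega> = ln (c (\<omega> 0)) + ln (ratio r (\<omega> 0) (V n (shift \<omega>)))" for n \<omega>
    unfolding f_def using c ratio_bds(1) by (intro ln_mult_pos) (auto intro: less_le_trans[OF zero_less_one])
  have telescope: "ln ((\<Prod>k<n. c (\<omega> k)) * total (V n \<omega>))
      = ln (total v) + (\<Sum>k<n. f (n - Suc k) ((shift ^^ k) \<omega>))" for n \<omega>
  proof (induction n arbitrary: \<omega>)
    case 0
    then show ?case by (simp add: V_def)
  next
    case (Suc n)
    have p: "0 < (\<Prod>k<n. c (shift \<omega> k)) * total (V n (shift \<omega>))"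
      using c totV[of n "shift \<omega>"] by (intro mult_pos_pos prod_pos) auto
    have p': "0 < c (\<omega> 0) * ratio r (\<omega> 0) (V n (shift \<omega>))"
      using c[of "\<omega> 0"] ratio_bds(1)[of "\<omega> 0" n "shift \<omega>"] by (intro mult_pos_pos) auto
    have "(\<Prod>k<Suc n. c (\<omega> k)) * total (V (Suc n) \<omega>)
        = c (\<omega> 0) * ratio r (\<omega> 0) (V n (shift \<omega>)) * ((\<Prod>k<n. c (shift \<omega> k)) * total (V n (shift \<omega>)))"
      using totV[of n "shift \<omega>"]
      by (simp add: prod.lessThan_Suc_shift V_Suc ratio_def shift_def del: prod.lessThan_Suc)
    then have "ln ((\<Prod>k<Suc n. c (\<omega> k)) * total (V (Suc n) \<omega>))
        = f n \<omega> + ln ((\<Prod>k<n. c (shift \<omega> k)) * total (V n (shift \<omega>)))"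
      using ln_mult_pos[OF p' p] by (simp add: f_def)
    also have "\<dots> = ln (total v) + (f n \<omega> + (\<Sum>k<n. f (n - Suc k) ((shift ^^ k) (shift \<omega>))))"
      by (simp add: Suc)
    also have "f n \<omega> + (\<Sum>k<n. f (n - Suc k) ((shift ^^ k) (shift \<omega>)))
        = (\<Sum>k<Suc n. f (Suc n - Suc k) ((shift ^^ k) \<omega>))"
      by (simp add: sum.lessThan_Suc_shift funpow_Suc_right del: sum.lessThan_Suc funpow.simps(2))
    finally show ?case .
  qed
  define C where "C = (\<Sum>d<s. \<bar>ln (c d)\<bar>) + ln (2 * r)"
  have bdd: "\<bar>f n \<omega>\<bar> \<le> C" if "\<omega> \<in> Omega s" for n \<omega>
  proof -
    have "\<bar>ln (c (\<omega> 0))\<bar> \<le> (\<Sum>d<s. \<bar>ln (c d)\<bar>)"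
      using that by (intro member_le_sum[of "\<omega> 0" _ "\<lambda>d. \<bar>ln (c d)\<bar>"]) (auto simp: Omega_def)
    moreover have "0 \<le> ln (ratio r (\<omega> 0) (V n (shift \<omega>)))" "ln (ratio r (\<omega> 0) (V n (shift \<omega>))) \<le> ln (2 * r)"
      using ratio_bds[of "\<omega> 0" n "shift \<omega>"] by (simp_all add: ln_mono)
    ultimately show ?thesis unfolding f_eq C_def by linarith
  qed
  have cont: "continuous_on (Omega s) (f n)" for n
  proof (rule continuous_on_finite_memory[where N = "Suc n"])
    fix \<omega> \<omega>' :: "nat \<Rightarrow> nat" assume *: "\<And>i. i < Suc n \<Longrightarrow> \<omega> i = \<omega>' i"
    then have "map (shift \<omega>) [0..<n] = map (shift \<omega>') [0..<n]" by (simp add: shift_def)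
    then show "f n \<omega> = f n \<omega>'" using *[of 0] by (simp only: f_def V_def)
  qed
  have diff: "\<bar>f n \<omega> - f n' \<omega>\<bar> \<le> 4 * r * modulus r n" if "n \<le> n'" for n n' \<omega>
  proof -
    have "[0..<n'] = [0..<n] @ [n..<n']" using that by (metis le0 upt_add_eq_append le_Suc_ex add_0)
    then have "V n' (shift \<omega>) = steps r (map (shift \<omega>) [0..<n] @ map (shift \<omega>) [n..<n']) v"
      by (simp add: V_def)
    then have "\<bar>ratio r (\<omega> 0) (V n (shift \<omega>)) - ratio r (\<omega> 0) (V n' (shift \<omega>))\<bar> \<le> 4 * r * modulus r n"
      using ratio_diff_extension[OF r v(1) _ v(3), of "\<omega> 0" "map (shift \<omega>) [0..<n]" "map (shift \<omega>) [n..<n']"]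
        v(2) by (simp add: V_def)
    moreover have "\<bar>f n \<omega> - f n' \<omega>\<bar> \<le> \<bar>ratio r (\<omega> 0) (V n (shift \<omega>)) - ratio r (\<omega> 0) (V n' (shift \<omega>))\<bar>"
      unfolding f_eq using abs_ln_diff_le ratio_bds(1) by simp
    ultimately show ?thesis by linarith
  qed
  have "uniformly_Cauchy_on (Omega s) f"
  proof (rule uniformly_Cauchy_onI')
    fix e :: real assume "0 < e"
    have "(\<lambda>n. 4 * r * modulus r n) \<longlonglongrightarrow> 0"
      using modulus_tendsto[OF r] by (rule tendsto_mult_right_zero)
    then obtain N where N: "\<And>n. n \<ge> N \<Longrightarrow> 4 * r * modulus r n < e"
      using order_tendstoD(2)[OF _ \<open>0 < e\<close>] by (force simp: eventually_sequentially)
    show "\<exists>M. \<forall>x\<in>Omega s. \<forall>n\<ge>M. \<forall>n'>n. dist (f n x) (f n' x) < e"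
    proof (intro exI[of _ N] ballI allI impI)
      fix \<omega> n n' assume "n \<ge> N" "n' > n"
      then show "dist (f n \<omega>) (f n' \<omega>) < e"
        using N[of n] diff[of n n' \<omega>] by (simp add: dist_real_def)
    qed
  qed
  then obtain \<phi> where lim: "uniform_limit (Omega s) f \<phi> sequentially"
    using Cauchy_uniformly_convergent unfolding uniformly_convergent_on_def by blast
  \<comment> \<open>ln 3 accounts for the total of v, which lies between 1 and 3; 2 * n + 3 = 1 + 2
    * (n + 1) is the factor between total and first entry supplied by
    \<open>dominated_steps\<close>.\<close>
  define b where "b n = ln 3 + ln (2 * real n + 3)" for n
  have "(\<lambda>n. b n / real n) \<longlonglongrightarrow> 0" unfolding b_def by real_asymp
  moreover have pos: "0 < (\<Prod>k<n. c (\<omega> k))" for n \<omega> using c by (intro prod_pos) auto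
  moreover have "0 < measure m (cylinder s (map \<omega> [0..<n]))" if "\<omega> \<in> Omega s" for n \<omega>
    unfolding meas[OF that] using pos fstV[of n \<omega>] by (intro mult_pos_pos) (auto simp: V_def)
  moreover have "\<bar>ln (measure m (cylinder s (map \<omega> [0..<n]))) - (\<Sum>k<n. f (n - Suc k) ((shift ^^ k) \<omega>))\<bar> \<le> b n"
    if "\<omega> \<in> Omega s" for n \<omega>
  proof -
    let ?c = "\<Prod>k<n. c (\<omega> k)"
    have "ln (measure m (cylinder s (map \<omega> [0..<n]))) = ln ?c + ln (fst (V n \<omega>))"
      unfolding meas[OF that] V_def[symmetric] using pos fstV[of n \<omega>] by (intro ln_mult_pos) auto
    moreover have "ln (?c * total (V n \<omega>)) = ln ?c + ln (total (V n \<omega>))"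
      using pos totV[of n \<omega>] by (intro ln_mult_pos) auto
    moreover have "ln (fst (V n \<omega>)) \<le> ln (total (V n \<omega>))"
      using fstV[of n \<omega>] fst_le_total[OF nnV, of n \<omega>] by simp
    moreover have "ln (total (V n \<omega>)) \<le> ln (2 * real n + 3) + ln (fst (V n \<omega>))"
    proof -
      have "total (V n \<omega>) \<le> (1 + 2 * (real n + 1)) * fst (V n \<omega>)"
        using dominated_steps[OF r v(1,3), of "map \<omega> [0..<n]"]
        by (intro fst_ge_total nnV) (simp add: V_def)
      also have "1 + 2 * (real n + 1) = 2 * real n + 3" by simp
      finally have "ln (total (V n \<omega>)) \<le> ln ((2 * real n + 3) * fst (V n \<omega>))"
        using totV[of n \<omega>] by (intro ln_mono) auto
      also have "\<dots> = ln (2 * real n + 3) + ln (fst (V n \<omega>))"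
        using fstV[of n \<omega>] by (intro ln_mult_pos) auto
      finally show ?thesis .
    qed
    moreover have "0 \<le> ln (total v)" "ln (total v) \<le> ln 3" using totv by simp_all
    moreover have "0 \<le> ln (2 * real n + 3)" by simp
    ultimately show ?thesis using telescope[where n=n and \<omega>=\<omega>] unfolding b_def by linarith
  qed
  ultimately show ?thesis
    using weak_gibbsI[OF m cont lim bdd] by blast
qed

section \<open>Expansions in the base minus golden ratio\<close>

lemma beta_gt_1: "1 < beta"
  using real_less_rsqrt[of 1 5] by (simp add: beta_def)

lemma beta_squared: "beta * beta = beta + 1"
  by (simp add: beta_def field_simps)

lemma inverse_beta: "1 / beta = beta - 1"
  using beta_squared beta_gt_1 by (simp add: field_simps)

lemma inverse_beta_squared: "1 / beta\<^sup>2 = 2 - beta"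
proof -
  have "(2 - beta) * beta\<^sup>2 = 1" using beta_squared by algebra
  then show ?thesis using beta_gt_1 by (simp add: field_simps)
qed

lemma beta_lt_2: "beta < 2"
  using inverse_beta_squared beta_gt_1 by (smt (verit) zero_less_divide_1_iff zero_less_power)

lemma divide_beta: "x / beta = x * (beta - 1)"
  using inverse_beta by (metis times_divide_eq_right mult.right_neutral)

lemma norm_digit_le:
  assumes "\<omega> \<in> Omega 2"
  shows "norm (real (\<omega> n) / (- beta) ^ (n + 2)) \<le> (1 / beta) ^ n"
proof -
  have "\<omega> n < 2" using assms by (simp add: Omega_def)
  then have "real (\<omega> n) \<le> 1" by linarith
  moreover have "beta ^ n \<le> beta ^ (n + 2)" using beta_gt_1 by (intro power_increasing) auto
  ultimately have "real (\<omega> n) / beta ^ (n + 2) \<le> 1 / beta ^ n"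
    using beta_gt_1 by (intro frac_le) auto
  moreover have "norm ((- beta) ^ (n + 2)) = beta ^ (n + 2)"
    using beta_gt_1 by (subst norm_power) simp
  then have "norm (real (\<omega> n) / (- beta) ^ (n + 2)) = real (\<omega> n) / beta ^ (n + 2)"
    by (simp only: norm_divide norm_of_nat)
  ultimately show ?thesis by (simp only: power_one_over)
qed

lemma summable_digits:
  assumes "\<omega> \<in> Omega 2"
  shows "summable (\<lambda>n. real (\<omega> n) / (- beta) ^ (n + 2))"
proof (rule summable_comparison_test')
  show "summable (\<lambda>n. (1 / beta) ^ n)"
    using beta_gt_1 by (intro summable_geometric) simp
qed (rule norm_digit_le[OF assms])

text \<open>Splitting off the first digit rescales the rest of the series by -1 /
  \<open>beta\<close>; the constants simplify because \<open>beta\<close> * \<open>beta\<close> =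
  \<open>beta\<close> + 1.\<close>

lemma Y_rec:
  assumes "\<omega> \<in> Omega 2"
  shows "Y \<omega> = (if \<omega> 0 = 0 then 1 - Y (shift \<omega>) / beta else (1 - Y (shift \<omega>)) / beta)"
proof -
  have s: "shift \<omega> \<in> Omega 2" using shift_Omega[OF assms, of 1] by simp
  let ?T = "\<Sum>n. real (shift \<omega> n) / (- beta) ^ (n + 2)"
  have "(\<Sum>n. real (\<omega> n) / (- beta) ^ (n + 2))
      = (\<Sum>n. real (\<omega> (Suc n)) / (- beta) ^ (Suc n + 2)) + real (\<omega> 0) / (- beta) ^ (0 + 2)"
    using suminf_split_head[OF summable_digits[OF assms]] by (simp only: diff_add_cancel)
  also have "(\<Sum>n. real (\<omega> (Suc n)) / (- beta) ^ (Suc n + 2)) = (\<Sum>n. (real (shift \<omega> n) / (- beta) ^ (n + 2)) / (- beta))"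
    by (simp add: shift_def field_simps)
  also have "\<dots> = ?T / (- beta)" by (rule suminf_divide[OF summable_digits[OF s]])
  finally have "Y \<omega> = 1 / beta + ?T / beta - real (\<omega> 0) / beta\<^sup>2" by (simp add: Y_def power2_eq_square)
  moreover have "?T = 1 / beta - Y (shift \<omega>)" by (simp add: Y_def)
  ultimately have *: "Y \<omega> = 1 / beta + (1 / beta - Y (shift \<omega>)) / beta - real (\<omega> 0) * (1 / beta\<^sup>2)"
    by simp
  have d: "\<omega> 0 = 0 \<or> \<omega> 0 = 1" using assms by (auto simp: Omega_def less_2_cases_iff)
  show ?thesis
  proof (cases "\<omega> 0 = 0")
    case True
    have "Y \<omega> = (beta - 1) + (beta - 1 - Y (shift \<omega>)) * (beta - 1)"
      using * True by (simp add: divide_beta)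
    also have "\<dots> = 1 - Y (shift \<omega>) * (beta - 1)" using beta_squared by algebra
    finally show ?thesis using True by (simp add: divide_beta)
  next
    case False
    then have "\<omega> 0 = 1" using d by simp
    then have "Y \<omega> = (beta - 1) + (beta - 1 - Y (shift \<omega>)) * (beta - 1) - (2 - beta)"
      using * unfolding inverse_beta_squared by (simp add: divide_beta)
    also have "\<dots> = (1 - Y (shift \<omega>)) * (beta - 1)" using beta_squared by algebra
    finally show ?thesis using False by (simp add: divide_beta)
  qed
qed

lemma Y_bounded:
  assumes "\<omega> \<in> Omega 2"
  shows "\<bar>Y \<omega>\<bar> \<le> 1 / beta + (\<Sum>n. (1 / beta) ^ n)"
proof -
  have "norm (\<Sum>n. real (\<omega> n) / (- beta) ^ (n + 2)) \<le> (\<Sum>n. (1 / beta) ^ n)"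
  proof (rule norm_suminf_le)
    show "summable (\<lambda>n. (1 / beta) ^ n)"
      using beta_gt_1 by (intro summable_geometric) simp
  qed (rule norm_digit_le[OF assms])
  moreover have "0 < 1 / beta" using beta_gt_1 by simp
  ultimately show ?thesis unfolding Y_def real_norm_def by linarith
qed

text \<open>Both branches map [- D, 1 + D] into [- D / \<open>beta\<close>, 1 + D /
  \<open>beta\<close>], so any a priori bound on the overshoot improves geometrically.\<close>

lemma Y_range_approx:
  assumes "\<omega> \<in> Omega 2" "0 \<le> C" "\<And>\<omega>'. \<omega>' \<in> Omega 2 \<Longrightarrow> - C \<le> Y \<omega>' \<and> Y \<omega>' \<le> 1 + C"
  shows "- (C / beta ^ n) \<le> Y \<omega> \<and> Y \<omega> \<le> 1 + C / beta ^ n"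
  using assms(1)
proof (induction n arbitrary: \<omega>)
  case 0
  then show ?case using assms(3) by simp
next
  case (Suc n)
  have s: "shift \<omega> \<in> Omega 2" using shift_Omega[OF Suc.prems, of 1] by simp
  let ?y = "Y (shift \<omega>)" and ?D = "C / beta ^ n"
  have IH: "- ?D \<le> ?y" "?y \<le> 1 + ?D" using Suc.IH[OF s] by auto
  have "- ?D / beta \<le> ?y / beta" "?y / beta \<le> (1 + ?D) / beta"
    using IH beta_gt_1 by (intro divide_right_mono; simp)+
  then have "- (C / beta ^ Suc n) \<le> ?y / beta" "?y / beta \<le> 1 / beta + C / beta ^ Suc n"
    by (simp_all add: add_divide_distrib mult.commute)
  moreover have "0 < 1 / beta" "1 / beta < 1" using beta_gt_1 by simp_all
  ultimately have "- (C / beta ^ Suc n) \<le> 1 - ?y / beta \<and> 1 - ?y / beta \<le> 1 + C / beta ^ Suc n"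
    "- (C / beta ^ Suc n) \<le> 1 / beta - ?y / beta \<and> 1 / beta - ?y / beta \<le> 1 + C / beta ^ Suc n"
    by linarith+
  then show ?case
    unfolding Y_rec[OF Suc.prems] diff_divide_distrib by simp
qed

lemma Y_range:
  assumes "\<omega> \<in> Omega 2"
  shows "0 \<le> Y \<omega>" "Y \<omega> \<le> 1"
proof -
  define C where "C = 1 / beta + (\<Sum>n. (1 / beta) ^ n)"
  have C: "\<bar>Y \<omega>'\<bar> \<le> C" if "\<omega>' \<in> Omega 2" for \<omega>'
    using Y_bounded[OF that] by (simp add: C_def)
  then have "0 \<le> C" using assms by fastforce
  then have *: "- (C / beta ^ n) \<le> Y \<omega> \<and> Y \<omega> \<le> 1 + C / beta ^ n" for n
  proof (rule Y_range_approx[OF assms])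
    show "- C \<le> Y \<omega>' \<and> Y \<omega>' \<le> 1 + C" if "\<omega>' \<in> Omega 2" for \<omega>' using C[OF that] by linarith
  qed
  have "(\<lambda>n. (1 / beta) ^ n) \<longlonglongrightarrow> 0" using beta_gt_1 by (intro LIMSEQ_realpow_zero) auto
  then have "(\<lambda>n. C * (1 / beta) ^ n) \<longlonglongrightarrow> 0" by (rule tendsto_mult_right_zero)
  then have lim: "(\<lambda>n. C / beta ^ n) \<longlonglongrightarrow> 0" by (simp add: power_divide)
  show "0 \<le> Y \<omega>" using LIMSEQ_le_const2[OF tendsto_minus[OF lim], of "Y \<omega>"] * by auto
  show "Y \<omega> \<le> 1" using LIMSEQ_le_const[OF tendsto_add[OF tendsto_const lim], of "Y \<omega>" 1] * by auto
qed

section \<open>The expansions of the endpoints 0 and 1\<close>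

abbreviation (input) alternating :: "nat \<Rightarrow> nat" where
  "alternating \<equiv> \<lambda>k. if even k then 1 else 0"

lemma shift_shift_alternating: "shift (shift alternating) = alternating"
  by (simp add: shift_def)

lemma Y_alternating: "Y alternating = 0"
proof -
  have O: "alternating \<in> Omega 2" by (simp add: Omega_def)
  then have O': "shift alternating \<in> Omega 2" using shift_Omega[of _ 2 1] by simp
  have "Y alternating = (1 - Y (shift alternating)) / beta" by (subst Y_rec[OF O]) simp
  also have "Y (shift alternating) = 1 - Y alternating / beta"
    by (subst Y_rec[OF O']) (simp only: shift_shift_alternating, simp add: shift_def)
  finally have "Y alternating * (beta * beta) = Y alternating"
    using beta_gt_1 by (simp add: field_simps)
  then show ?thesis using beta_squared beta_gt_1 by (simp add: algebra_simps)
qed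

text \<open>The digit 0 yields values of at least 1 - 1 / \<open>beta\<close> > 0, so 0 arises only
  from the digit 1 and a tail of value 1. With \<open>Y_eq_1D\<close> this makes the alternating
  sequence the only expansion of 0.\<close>

lemma Y_eq_0D:
  assumes "\<omega> \<in> Omega 2" "Y \<omega> = 0"
  shows "\<omega> 0 = 1" "Y (shift \<omega>) = 1"
proof -
  have s: "shift \<omega> \<in> Omega 2" using shift_Omega[OF assms(1), of 1] by simp
  have "Y (shift \<omega>) / beta < 1" using Y_range[OF s] beta_gt_1 by simp
  then have "\<omega> 0 \<noteq> 0" using Y_rec[OF assms(1)] assms(2) by (intro notI) simp
  moreover have "\<omega> 0 < 2" using assms(1) by (simp add: Omega_def)
  ultimately show "\<omega> 0 = 1" by linarith
  then show "Y (shift \<omega>) = 1" using Y_rec[OF assms(1)] assms(2) beta_gt_1 by simp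
qed

lemma Y_eq_1D:
  assumes "\<omega> \<in> Omega 2" "Y \<omega> = 1"
  shows "\<omega> 0 = 0" "Y (shift \<omega>) = 0"
proof -
  have s: "shift \<omega> \<in> Omega 2" using shift_Omega[OF assms(1), of 1] by simp
  have "(1 - Y (shift \<omega>)) / beta < 1" using Y_range[OF s] beta_gt_1 by simp
  then show "\<omega> 0 = 0" using Y_rec[OF assms(1)] assms(2) by (auto split: if_splits)
  then show "Y (shift \<omega>) = 0" using Y_rec[OF assms(1)] assms(2) beta_gt_1 by simp
qed

lemma Y_eq_0_imp_alternating:
  assumes "\<omega> \<in> Omega 2" "Y \<omega> = 0"
  shows "\<omega> = alternating"
proof
  fix n
  show "\<omega> n = alternating n" using assms
  proof (induction n arbitrary: \<omega> rule: induct_nat_012)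
    case 0
    then show ?case using Y_eq_0D by simp
  next
    case 1
    then show ?case
      using Y_eq_1D(1)[of "shift \<omega>"] Y_eq_0D(2)[of \<omega>] shift_Omega[of \<omega> 2 1] by (simp add: shift_def)
  next
    case (ge2 n)
    have s: "shift \<omega> \<in> Omega 2" "shift (shift \<omega>) \<in> Omega 2"
      using shift_Omega[OF ge2.prems(1), of 1] shift_Omega[OF ge2.prems(1), of 2]
      by (simp_all add: numeral_2_eq_2)
    have "Y (shift (shift \<omega>)) = 0"
      using Y_eq_1D(2)[OF s(1)] Y_eq_0D(2)[OF ge2.prems] by simp
    then show ?case using ge2.IH(1)[OF s(2)] by (simp add: shift_def)
  qed
qed

text \<open>The expansion of \<open>x\<close> is the orbit of a piecewise affine expanding map. As every branch
  reverses the orientation, the half-open domain alternates between \<open>[0,1)\<close> (orientation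
  \<open>True\<close>) and \<open>(0,1]\<close> (orientation \<open>False\<close>).\<close>

definition dom_of :: "bool \<Rightarrow> real set" where
  "dom_of s = (if s then {0..<1} else {0<..1})"

text \<open>The tie at \<open>1 / beta\<^sup>2\<close> is forced. In orientation \<open>True\<close>
  the digit 1 would map this point to itself, where orientation \<open>False\<close> gives the digit
  1 again, against the ban on 11. In orientation \<open>False\<close> the digit 0 would map it to 1,
  outside [0, 1).\<close>

definition digit :: "bool \<Rightarrow> real \<Rightarrow> nat" where
  "digit s x = (if x < 1 / beta\<^sup>2 \<or> \<not> s \<and> x = 1 / beta\<^sup>2 then 1 else 0)"

definition successor :: "bool \<Rightarrow> real \<Rightarrow> real" where
  "successor s x = (if digit s x = 0 then beta * (1 - x) else 1 - beta * x)"

fun expansion :: "bool \<Rightarrow> real \<Rightarrow> nat \<Rightarrow> nat" where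
  "expansion s x 0 = digit s x"
| "expansion s x (Suc n) = expansion (\<not> s) (successor s x) n"

lemma shift_expansion: "shift (expansion s x) = expansion (\<not> s) (successor s x)"
  by (simp add: shift_def)

lemma dom_of_unit: "x \<in> dom_of s \<Longrightarrow> 0 \<le> x \<and> x \<le> 1"
  by (auto simp: dom_of_def split: if_splits)

lemma digit_0_branch:
  assumes "y \<in> dom_of (\<not> s)"
  shows "1 - y / beta \<in> dom_of s" "digit s (1 - y / beta) = 0" "successor s (1 - y / beta) = y"
proof -
  have y: "0 \<le> y" "y \<le> 1" "s \<Longrightarrow> 0 < y" "\<not> s \<Longrightarrow> y < 1"
    using assms by (auto simp: dom_of_def split: if_splits)
  have "y / beta \<le> 1 / beta" "\<not> s \<Longrightarrow> y / beta < 1 / beta" "0 \<le> y / beta" "s \<Longrightarrow> 0 < y / beta"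
    using y beta_gt_1 by (auto simp: divide_right_mono divide_strict_right_mono)
  then have *: "y / beta \<le> beta - 1" "\<not> s \<Longrightarrow> y / beta < beta - 1" "0 \<le> y / beta" "s \<Longrightarrow> 0 < y / beta"
    unfolding inverse_beta by auto
  have "0 \<le> 1 - y / beta" "1 - y / beta \<le> 1" using *(1,3) beta_lt_2 by linarith+
  moreover have "1 - y / beta < 1" if s using *(4)[OF that] by linarith
  moreover have "0 < 1 - y / beta" if "\<not> s" using *(2)[OF that] beta_lt_2 by linarith
  ultimately show 1: "1 - y / beta \<in> dom_of s"
    unfolding dom_of_def by (cases s) (simp_all only: if_True if_False atLeastLessThan_iff greaterThanAtMost_iff simp_thms)
  show 2: "digit s (1 - y / beta) = 0"
    using * unfolding digit_def inverse_beta_squared by auto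
  show "successor s (1 - y / beta) = y" using beta_gt_1 by (simp add: successor_def 2)
qed

text \<open>The premise on the digit of y expresses the ban on 11. It keeps y at or above
  \<open>1 / beta\<^sup>2\<close>, and \<open>1 - 1 / beta\<^sup>2 = 1 / beta\<close> makes the
  image end exactly at the cut.\<close>

lemma digit_1_branch:
  assumes "y \<in> dom_of (\<not> s)" "digit (\<not> s) y = 0"
  shows "(1 - y) / beta \<in> dom_of s" "digit s ((1 - y) / beta) = 1" "successor s ((1 - y) / beta) = y"
proof -
  have y: "1 / beta\<^sup>2 \<le> y" "s \<Longrightarrow> 1 / beta\<^sup>2 < y" "y \<le> 1" "\<not> s \<Longrightarrow> y < 1"
    using assms by (auto simp: dom_of_def digit_def split: if_splits)
  have b: "1 - 1 / beta\<^sup>2 = 1 / beta" "1 / beta / beta = 1 / beta\<^sup>2" "1 / beta\<^sup>2 < 1"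
    using beta_gt_1 by (simp_all only: inverse_beta inverse_beta_squared)
      (simp_all add: inverse_beta[symmetric] inverse_beta_squared[symmetric] power2_eq_square)
  have "(1 - y) / beta \<le> 1 / beta / beta" "s \<Longrightarrow> (1 - y) / beta < 1 / beta / beta"
    "0 \<le> (1 - y) / beta" "\<not> s \<Longrightarrow> 0 < (1 - y) / beta"
    using y b(1) beta_gt_1 by (auto simp del: divide_divide_eq_left intro!: divide_right_mono divide_strict_right_mono)
  then have "(1 - y) / beta \<in> dom_of s \<and> digit s ((1 - y) / beta) = 1"
    unfolding b(2) using b(3) by (auto simp: dom_of_def digit_def)
  then show "(1 - y) / beta \<in> dom_of s" "digit s ((1 - y) / beta) = 1" by auto
  then show "successor s ((1 - y) / beta) = y" using beta_gt_1 by (simp add: successor_def)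
qed

lemma successor_dom:
  assumes "x \<in> dom_of s"
  shows "successor s x \<in> dom_of (\<not> s)"
    "digit s x = 1 \<Longrightarrow> digit (\<not> s) (successor s x) = 0"
    "x = (if digit s x = 0 then 1 - successor s x / beta else (1 - successor s x) / beta)"
proof -
  have "beta * (2 - beta) = beta - 1" using beta_squared by algebra
  then have b: "beta * (1 / beta\<^sup>2) = beta - 1" "1 / beta\<^sup>2 = 2 - beta"
    by (simp_all only: inverse_beta_squared)
  have x: "0 \<le> x" "x \<le> 1" "s \<Longrightarrow> x < 1" "\<not> s \<Longrightarrow> 0 < x"
    using assms by (auto simp: dom_of_def split: if_splits)
  show "x = (if digit s x = 0 then 1 - successor s x / beta else (1 - successor s x) / beta)"
    using beta_gt_1 by (simp add: successor_def)
  have "successor s x \<in> dom_of (\<not> s) \<and> (digit s x = 1 \<longrightarrow> digit (\<not> s) (successor s x) = 0)"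
  proof (cases "digit s x = 0")
    case True
    then have "1 / beta\<^sup>2 \<le> x" "\<not> s \<Longrightarrow> 1 / beta\<^sup>2 < x" by (auto simp: digit_def split: if_splits)
    then have "beta * (1 / beta\<^sup>2) \<le> beta * x" "\<not> s \<Longrightarrow> beta * (1 / beta\<^sup>2) < beta * x"
      using beta_gt_1 by (auto simp del: times_divide_eq_right)
    moreover have "beta * x \<le> beta * 1" "s \<Longrightarrow> beta * x < beta * 1"
      using x beta_gt_1 by auto
    ultimately show ?thesis using True unfolding b(1)
      by (auto simp: successor_def dom_of_def algebra_simps)
  next
    case False
    then have "x \<le> 1 / beta\<^sup>2" "s \<Longrightarrow> x < 1 / beta\<^sup>2" by (auto simp: digit_def split: if_splits)
    then have "beta * x \<le> beta * (1 / beta\<^sup>2)" "s \<Longrightarrow> beta * x < beta * (1 / beta\<^sup>2)"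
      using beta_gt_1 by (auto simp del: times_divide_eq_right)
    moreover have "0 \<le> beta * x" "\<not> s \<Longrightarrow> 0 < beta * x"
      using x beta_gt_1 by auto
    ultimately have *: "1 / beta\<^sup>2 \<le> 1 - beta * x" "s \<Longrightarrow> 1 / beta\<^sup>2 < 1 - beta * x"
      "1 - beta * x \<le> 1" "\<not> s \<Longrightarrow> 1 - beta * x < 1"
      unfolding b(1) unfolding b(2) by auto
    have "successor s x = 1 - beta * x" using False by (simp add: successor_def)
    then show ?thesis using * beta_lt_2 unfolding digit_def dom_of_def b(2) by auto
  qed
  then show "successor s x \<in> dom_of (\<not> s)" "digit s x = 1 \<Longrightarrow> digit (\<not> s) (successor s x) = 0"
    by auto
qed

section \<open>Existence and uniqueness of admissible expansions\<close>

lemma expansion_Omega: "expansion s x \<in> Omega 2"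
proof -
  have "expansion s x n < 2" for n
    by (induction n arbitrary: s x) (auto simp: digit_def)
  then show ?thesis by (simp add: Omega_def)
qed

text \<open>x and the value of its expansion obey the same recursion, whose branches contract by the
  factor \<open>beta\<close>; both lie in the unit interval, so their distance is at most
  \<open>(1 / beta) ^ n\<close> for every n.\<close>

lemma Y_expansion:
  assumes "x \<in> dom_of s"
  shows "Y (expansion s x) = x"
proof -
  have *: "\<bar>Y (expansion s x) - x\<bar> \<le> (1 / beta) ^ n" for n
    using assms
  proof (induction n arbitrary: s x)
    case 0
    then show ?case using Y_range[OF expansion_Omega, of s x] dom_of_unit[of x s] by (simp add: abs_le_iff)
  next
    case (Suc n)
    let ?y = "successor s x"
    have IH: "\<bar>Y (expansion (\<not> s) ?y) - ?y\<bar> \<le> (1 / beta) ^ n"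
      using Suc.IH successor_dom(1)[OF Suc.prems] by blast
    have "\<bar>Y (expansion s x) - x\<bar> = \<bar>Y (expansion (\<not> s) ?y) - ?y\<bar> / beta"
      using successor_dom(3)[OF Suc.prems] beta_gt_1
      by (subst Y_rec[OF expansion_Omega])
        (cases "digit s x = 0"; simp add: shift_expansion abs_minus_commute diff_divide_distrib[symmetric]
          flip: abs_divide; simp add: abs_divide field_simps)
    also have "\<dots> \<le> (1 / beta) ^ n / beta" using IH beta_gt_1 by (intro divide_right_mono) auto
    finally show ?case by simp
  qed
  have "(\<lambda>n. (1 / beta) ^ n) \<longlonglongrightarrow> 0" using beta_gt_1 by (intro LIMSEQ_realpow_zero) auto
  then have "\<bar>Y (expansion s x) - x\<bar> \<le> 0"
    using * by (intro LIMSEQ_le_const) auto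
  then show ?thesis by simp
qed

lemma expansion_no_11:
  assumes "x \<in> dom_of s"
  shows "\<not> (expansion s x n = 1 \<and> expansion s x (Suc n) = 1)"
  using assms
proof (induction n arbitrary: s x)
  case 0
  then show ?case using successor_dom(2)[of x s] by auto
next
  case (Suc n)
  then show ?case using Suc.IH[OF successor_dom(1)[OF Suc.prems]] by simp
qed

text \<open>A version of \<open>admissible\<close> compatible with shifts: each shift flips both the
  orientation and the parity of the positions where an alternating tail is forbidden. Such a tail
  would have value 0 in orientation \<open>False\<close>, where \<open>dom_of\<close> omits
  0.\<close>

definition admissible_from :: "bool \<Rightarrow> (nat \<Rightarrow> nat) \<Rightarrow> bool" where
  "admissible_from s a \<longleftrightarrow> a \<in> Omega 2 \<and> (\<forall>n. \<not> (a n = 1 \<and> a (Suc n) = 1)) \<and>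
     (\<forall>n. odd n = s \<longrightarrow> (shift ^^ n) a \<noteq> alternating)"

lemma admissible_iff: "admissible a \<longleftrightarrow> admissible_from True a"
  unfolding admissible_def admissible_from_def by (metis oddE odd_two_times_div_two_succ even_plus_one_iff even_mult_iff even_numeral)

lemma admissible_from_shift: "admissible_from s a \<Longrightarrow> admissible_from (\<not> s) (shift a)"
proof -
  assume a: "admissible_from s a"
  have "(shift ^^ n) (shift a) \<noteq> alternating" if "odd n = (\<not> s)" for n
  proof -
    have "odd (Suc n) = s" using that by auto
    then have "(shift ^^ Suc n) a \<noteq> alternating" using a unfolding admissible_from_def by blast
    then show ?thesis by (simp add: funpow_Suc_right del: funpow.simps)
  qed
  moreover have "\<not> (shift a n = 1 \<and> shift a (Suc n) = 1)" for n
    using a unfolding admissible_from_def shift_def by blast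
  moreover have "shift a \<in> Omega 2" using a shift_Omega[of a 2 1] by (simp add: admissible_from_def)
  ultimately show ?thesis unfolding admissible_from_def by blast
qed

lemma admissible_expansion:
  assumes "x \<in> dom_of s"
  shows "admissible_from s (expansion s x)"
proof -
  have "(shift ^^ n) (expansion s x) \<noteq> alternating" if "odd n = s" for n
    using assms that
  proof (induction n arbitrary: s x)
    case 0
    then have "0 < x" by (simp add: dom_of_def)
    then show ?case using Y_expansion[OF 0(1)] Y_alternating by fastforce
  next
    case (Suc n)
    then show ?case using successor_dom(1)[OF Suc.prems(1)]
      by (simp add: funpow_Suc_right shift_expansion del: funpow.simps)
  qed
  then show ?thesis using expansion_no_11[OF assms] expansion_Omega by (simp add: admissible_from_def)
qed

lemma admissible_Y_dom:
  assumes "admissible_from s a"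
  shows "Y a \<in> dom_of s"
proof -
  have a: "a \<in> Omega 2" "shift a \<in> Omega 2"
    using assms shift_Omega[of a 2 1] by (auto simp: admissible_from_def)
  have "Y a \<noteq> 1" if s
  proof
    assume "Y a = 1"
    then have "shift a = alternating" using Y_eq_1D(2)[OF a(1)] Y_eq_0_imp_alternating[OF a(2)] by simp
    moreover have "(shift ^^ 1) a \<noteq> alternating"
      using assms that unfolding admissible_from_def by (metis odd_one)
    ultimately show False by simp
  qed
  moreover have "Y a \<noteq> 0" if "\<not> s"
  proof
    assume "Y a = 0"
    then have "a = alternating" using Y_eq_0_imp_alternating[OF a(1)] by simp
    moreover have "(shift ^^ 0) a \<noteq> alternating"
      using assms that unfolding admissible_from_def by (metis even_zero)
    ultimately show False by simp
  qed
  ultimately show ?thesis using Y_range[OF a(1)] by (auto simp: dom_of_def less_le)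
qed

text \<open>A digit 1 is followed by 0, which is the premise of \<open>digit_1_branch\<close>. Thus
  the expanding map reads the digits of an admissible sequence off its value, and uniqueness follows
  by iteration.\<close>

lemma admissible_digit:
  assumes "admissible_from s a"
  shows "digit s (Y a) = a 0" "successor s (Y a) = Y (shift a)"
proof -
  have a: "a \<in> Omega 2" "shift a \<in> Omega 2"
    using assms shift_Omega[of a 2 1] by (auto simp: admissible_from_def)
  have d: "Y (shift a) \<in> dom_of (\<not> s)"
    using admissible_Y_dom admissible_from_shift assms by blast
  have "digit s (Y a) = a 0 \<and> successor s (Y a) = Y (shift a)"
  proof (cases "a 0 = 0")
    case True
    then show ?thesis using Y_rec[OF a(1)] digit_0_branch[OF d] by simp
  next
    case False
    have lt: "a 0 < 2" "a 1 < 2" using a(1) by (auto simp: Omega_def)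
    with False have a0: "a 0 = 1" by linarith
    then have "a 1 \<noteq> 1" using assms by (auto simp: admissible_from_def)
    then have a1: "shift a 0 = 0" using lt by (simp add: shift_def)
    have d2: "Y (shift (shift a)) \<in> dom_of (\<not> \<not> s)"
      using admissible_Y_dom admissible_from_shift assms by blast
    have "digit (\<not> s) (Y (shift a)) = 0" using Y_rec[OF a(2)] digit_0_branch[OF d2] a1 by simp
    then show ?thesis using Y_rec[OF a(1)] digit_1_branch[OF d] a0 by simp
  qed
  then show "digit s (Y a) = a 0" "successor s (Y a) = Y (shift a)" by auto
qed

lemma admissible_unique:
  assumes "admissible_from s a"
  shows "a = expansion s (Y a)"
proof
  fix n
  show "a n = expansion s (Y a) n" using assms
  proof (induction n arbitrary: s a)
    case 0
    then show ?case using admissible_digit by simp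
  next
    case (Suc n)
    have "shift a n = expansion (\<not> s) (Y (shift a)) n"
      using Suc.IH[OF admissible_from_shift[OF Suc.prems]] .
    then show ?case using admissible_digit(2)[OF Suc.prems] by (simp add: shift_def[of a])
  qed
qed

lemma alpha_eq_expansion:
  assumes "x \<in> {0..<1}"
  shows "alpha x = expansion True x"
proof -
  have x: "x \<in> dom_of True" using assms by (simp add: dom_of_def)
  show ?thesis unfolding alpha_def
  proof (rule the_equality)
    show "admissible (expansion True x) \<and> x = Y (expansion True x)"
      using admissible_expansion[OF x] Y_expansion[OF x] by (simp add: admissible_iff)
    show "a = expansion True x" if "admissible a \<and> x = Y a" for a
      using that admissible_unique[of True a] by (simp add: admissible_iff)
  qed
qed

section \<open>Parsing expansions into code words\<close>

definition block :: "(nat \<Rightarrow> nat) \<Rightarrow> nat" where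
  "block a = (if a 0 = 1 then 2 else if a 1 = 1 then 1 else 0)"

fun parse :: "(nat \<Rightarrow> nat) \<Rightarrow> nat \<Rightarrow> nat" where
  "parse a 0 = block a"
| "parse a (Suc n) = parse ((shift ^^ length (code_word (block a))) a) n"

text \<open>The ban on 11 is what makes parsing possible; it is preserved by shifts of any length
  without keeping track of the orientation.\<close>

definition golden :: "(nat \<Rightarrow> nat) \<Rightarrow> bool" where
  "golden a \<longleftrightarrow> a \<in> Omega 2 \<and> (\<forall>n. \<not> (a n = 1 \<and> a (Suc n) = 1))"

lemma golden_shift: "golden a \<Longrightarrow> golden ((shift ^^ k) a)"
  using shift_Omega[of a 2 k] by (simp add: golden_def shift_funpow)

lemma golden_expansion: "x \<in> dom_of s \<Longrightarrow> golden (expansion s x)"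
  using expansion_Omega expansion_no_11 by (auto simp: golden_def)

lemma block_less: "block a < 3"
  by (simp add: block_def)

lemma parse_Omega: "parse a \<in> Omega 3"
proof -
  have "parse a n < 3" for n by (induction n arbitrary: a) (simp_all add: block_less)
  then show ?thesis by (simp add: Omega_def)
qed

lemma shift_parse: "shift (parse a) = parse ((shift ^^ length (code_word (block a))) a)"
  by (simp add: shift_def fun_eq_iff)

lemma begins_with_append:
  "begins_with a (u @ v) \<longleftrightarrow> begins_with a u \<and> begins_with ((shift ^^ length u) a) v"
proof -
  have "map a [0..<length u + length v] = map a [0..<length u] @ map ((shift ^^ length u) a) [0..<length v]"
    by (rule nth_equalityI) (auto simp: nth_append shift_funpow)
  then show ?thesis by (simp add: begins_with_def)
qed

text \<open>The words 00, 010 and 10 form a prefix code, and in the absence of 11 every sequence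
  starts with one of them, since 1 is always followed by 0.\<close>

lemma begins_with_code_word:
  assumes "golden a" "d < 3"
  shows "begins_with a (code_word d) \<longleftrightarrow> block a = d"
proof -
  have lt: "a n = 0 \<or> a n = 1" for n
    using assms(1) by (auto simp: golden_def Omega_def less_2_cases_iff)
  have 1: "\<not> (a 0 = 1 \<and> a 1 = 1)" "\<not> (a 1 = 1 \<and> a 2 = 1)"
    using assms(1) unfolding golden_def by (metis One_nat_def numeral_2_eq_2)+
  have d: "d = 0 \<or> d = 1 \<or> d = 2" using assms(2) by auto
  show ?thesis
    using d lt[of 0] lt[of 1] lt[of 2] 1
    by (auto simp: begins_with_def code_word_def block_def upt_rec numeral_2_eq_2)
qed

lemma concat_code_word_Suc:
  "concat (map (\<lambda>k. code_word (s k)) [0..<Suc n])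
     = code_word (s 0) @ concat (map (\<lambda>k. code_word (shift s k)) [0..<n])"
  by (simp add: map_upt_Suc shift_def del: upt_Suc)

lemma begins_with_parse:
  "golden a \<Longrightarrow> begins_with a (concat (map (\<lambda>k. code_word (parse a k)) [0..<n]))"
proof (induction n arbitrary: a)
  case 0
  then show ?case by (simp add: begins_with_def)
next
  case (Suc n)
  then show ?case
    unfolding concat_code_word_Suc begins_with_append shift_parse
    using begins_with_code_word[OF Suc.prems block_less] golden_shift by simp
qed

lemma parse_unique:
  assumes "golden a" "s \<in> Omega 3"
    and "\<And>n. n \<ge> 1 \<Longrightarrow> begins_with a (concat (map (\<lambda>k. code_word (s k)) [0..<n]))"
  shows "s = parse a"
proof
  fix n
  show "s n = parse a n" using assms
  proof (induction n arbitrary: a s)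
    case 0
    have "begins_with a (code_word (s 0))" using 0(3)[of 1] by simp
    moreover have "s 0 < 3" using 0(2) by (simp add: Omega_def)
    ultimately show ?case using begins_with_code_word[OF 0(1)] by simp
  next
    case (Suc n)
    have "begins_with a (code_word (s 0))" using Suc.prems(3)[of 1] by simp
    moreover have "s 0 < 3" using Suc.prems(2) by (simp add: Omega_def)
    ultimately have b: "block a = s 0" using begins_with_code_word[OF Suc.prems(1)] by simp
    have "shift s n = parse ((shift ^^ length (code_word (s 0))) a) n"
    proof (rule Suc.IH)
      show "shift s \<in> Omega 3" using shift_Omega[OF Suc.prems(2), of 1] by simp
      show "begins_with ((shift ^^ length (code_word (s 0))) a) (concat (map (\<lambda>k. code_word (shift s k)) [0..<m]))" for m
        using Suc.prems(3)[of "Suc m"] unfolding concat_code_word_Suc begins_with_append by simp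
    qed (use golden_shift Suc.prems in blast)
    then show ?case by (simp add: shift_def[of s] b)
  qed
qed

lemma xi_star_eq_parse:
  assumes "x \<in> {0..<1}"
  shows "xi_star x = parse (expansion True x)"
proof -
  have g: "golden (expansion True x)" using assms by (intro golden_expansion) (simp add: dom_of_def)
  show ?thesis unfolding xi_star_def alpha_eq_expansion[OF assms]
    using begins_with_parse[OF g] parse_Omega parse_unique[OF g]
    by (intro the_equality) blast+
qed

text \<open>The images of \<open>B\<close> under the inverse branches \<open>y \<mapsto> 1 - y / \<beta>\<close> and \<open>y \<mapsto> (1 - y) / \<beta>\<close>.\<close>

definition image0 :: "real set \<Rightarrow> real set" where
  "image0 B = {x. beta * (1 - x) \<in> B}"

definition image1 :: "real set \<Rightarrow> real set" where
  "image1 B = {x. 1 - beta * x \<in> B}"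

definition branch :: "nat \<Rightarrow> real set \<Rightarrow> real set" where
  "branch d B = (if d = 0 then image0 (image0 B) else if d = 1 then image0 (image1 (image0 B))
     else image1 (image0 B))"

section \<open>Preimages of cylinders and measurability of the coding\<close>

definition preimage :: "bool \<Rightarrow> (nat \<Rightarrow> nat) set \<Rightarrow> real set" where
  "preimage s E = {x \<in> dom_of s. parse (expansion s x) \<in> E}"

lemma image0_eq:
  "{x \<in> dom_of s. digit s x = 0 \<and> Q (successor s x)} = image0 {y \<in> dom_of (\<not> s). Q y}"
proof (intro set_eqI iffI)
  fix x assume "x \<in> {x \<in> dom_of s. digit s x = 0 \<and> Q (successor s x)}"
  then show "x \<in> image0 {y \<in> dom_of (\<not> s). Q y}"
    using successor_dom(1)[of x s] by (auto simp: image0_def successor_def)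
next
  fix x assume x: "x \<in> image0 {y \<in> dom_of (\<not> s). Q y}"
  define y where "y = beta * (1 - x)"
  have "x = 1 - y / beta" using beta_gt_1 by (simp add: y_def)
  then show "x \<in> {x \<in> dom_of s. digit s x = 0 \<and> Q (successor s x)}"
    using x digit_0_branch[of y s] by (simp add: image0_def y_def)
qed

text \<open>After a digit 1 the digit 0 is automatic on the left; on the right it must be demanded,
  as otherwise the inverse branch would leave the piece with digit 1.\<close>

lemma image1_eq:
  "{x \<in> dom_of s. digit s x = 1 \<and> Q (successor s x)}
     = image1 {y \<in> dom_of (\<not> s). digit (\<not> s) y = 0 \<and> Q y}"
proof (intro set_eqI iffI)
  fix x assume "x \<in> {x \<in> dom_of s. digit s x = 1 \<and> Q (successor s x)}"
  then show "x \<in> image1 {y \<in> dom_of (\<not> s). digit (\<not> s) y = 0 \<and> Q y}"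
    using successor_dom(1,2)[of x s] by (auto simp: image1_def successor_def)
next
  fix x assume x: "x \<in> image1 {y \<in> dom_of (\<not> s). digit (\<not> s) y = 0 \<and> Q y}"
  define y where "y = 1 - beta * x"
  have "x = (1 - y) / beta" using beta_gt_1 by (simp add: y_def)
  then show "x \<in> {x \<in> dom_of s. digit s x = 1 \<and> Q (successor s x)}"
    using x digit_1_branch[of y s] by (simp add: image1_def y_def)
qed

text \<open>Every digit reverses the orientation, so among the code words only 010, of odd length,
  changes it. This is why both orientations are carried along.\<close>

lemma preimage_branch:
  assumes "d < 3"
  shows "preimage s {w. w 0 = d \<and> shift w \<in> E} = branch d (preimage (if d = 1 then \<not> s else s) E)"
proof -
  have dig: "digit s x = 0 \<or> digit s x = 1" for s x by (simp add: digit_def)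
  consider (0) "d = 0" | (1) "d = 1" | (2) "d = 2" using assms by linarith
  then show ?thesis
  proof cases
    case 0
    have "preimage s {w. w 0 = d \<and> shift w \<in> E} = {x \<in> dom_of s. digit s x = 0 \<and>
        (digit (\<not> s) (successor s x) = 0 \<and>
         parse (expansion s (successor (\<not> s) (successor s x))) \<in> E)}"
      using dig[of s] dig[of "\<not> s"]
      by (auto simp: 0 preimage_def shift_parse block_def code_word_def shift_expansion numeral_2_eq_2
          split: if_splits)
    also have "\<dots> = branch d (preimage s E)"
      unfolding image0_eq[where Q = "\<lambda>y. digit (\<not> s) y = 0 \<and> parse (expansion s (successor (\<not> s) y)) \<in> E"]
        image0_eq[where s = "\<not> s" and Q = "\<lambda>z. parse (expansion s z) \<in> E"]
      by (simp add: branch_def preimage_def 0)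
    finally show ?thesis by (simp add: 0)
  next
    case 1
    have "preimage s {w. w 0 = d \<and> shift w \<in> E} = {x \<in> dom_of s. digit s x = 0 \<and>
        (digit (\<not> s) (successor s x) = 1 \<and>
         parse (expansion (\<not> s) (successor s (successor (\<not> s) (successor s x)))) \<in> E)}"
      using dig[of s] dig[of "\<not> s"]
      by (auto simp: 1 preimage_def shift_parse block_def code_word_def shift_expansion numeral_3_eq_3
          split: if_splits)
    also have "\<dots> = branch d (preimage (\<not> s) E)"
      unfolding image0_eq[where Q = "\<lambda>y. digit (\<not> s) y = 1
            \<and> parse (expansion (\<not> s) (successor s (successor (\<not> s) y))) \<in> E"]
        image1_eq[where s = "\<not> s" and Q = "\<lambda>z. parse (expansion (\<not> s) (successor s z)) \<in> E"]
      \<comment> \<open>The final 0 of the word 010 is supplied by \<open>image1_eq\<close>.\<close>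
      using image0_eq[where s = s and Q = "\<lambda>z. parse (expansion (\<not> s) z) \<in> E"]
      by (simp add: branch_def preimage_def 1)
    finally show ?thesis by (simp add: 1)
  next
    case 2
    have "preimage s {w. w 0 = d \<and> shift w \<in> E} = {x \<in> dom_of s. digit s x = 1 \<and>
         parse (expansion s (successor (\<not> s) (successor s x))) \<in> E}"
      using dig[of s] dig[of "\<not> s"]
      by (auto simp: 2 preimage_def shift_parse block_def code_word_def shift_expansion numeral_2_eq_2
          split: if_splits)
    also have "\<dots> = branch d (preimage s E)"
      unfolding image1_eq[where Q = "\<lambda>y. parse (expansion s (successor (\<not> s) y)) \<in> E"]
        image0_eq[where s = "\<not> s" and Q = "\<lambda>z. parse (expansion s z) \<in> E"]
      by (simp add: branch_def preimage_def 2)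
    finally show ?thesis by (simp add: 2)
  qed
qed

lemma preimage_cylinder_Cons:
  assumes "d < 3"
  shows "preimage s (cylinder 3 (d # w)) = branch d (preimage (if d = 1 then \<not> s else s) (cylinder 3 w))"
proof -
  have "preimage s (cylinder 3 (d # w)) = preimage s {v. v 0 = d \<and> shift v \<in> cylinder 3 w}"
    using parse_Omega shift_Omega[OF parse_Omega, of 1]
    by (auto simp: preimage_def cylinder_def shift_def less_Suc_eq_0_disj)
  then show ?thesis using preimage_branch[OF assms] by simp
qed

lemma preimage_cylinder_Nil: "preimage s (cylinder 3 []) = dom_of s"
  using parse_Omega by (simp add: preimage_def cylinder_def)

lemma dom_of_borel [measurable]: "dom_of s \<in> sets borel"
  by (simp add: dom_of_def)

lemma image0_borel [measurable]: "B \<in> sets borel \<Longrightarrow> image0 B \<in> sets borel"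
  using measurable_sets[of "\<lambda>x. beta * (1 - x)" borel borel B] by (simp add: image0_def vimage_def)

lemma image1_borel [measurable]: "B \<in> sets borel \<Longrightarrow> image1 B \<in> sets borel"
  using measurable_sets[of "\<lambda>x. 1 - beta * x" borel borel B] by (simp add: image1_def vimage_def)

lemma branch_borel: "B \<in> sets borel \<Longrightarrow> branch d B \<in> sets borel"
  by (simp add: branch_def image0_borel image1_borel)

lemma preimage_UN_branch:
  "preimage s {w. shift w \<in> E} = (\<Union>d<3. branch d (preimage (if d = 1 then \<not> s else s) E))"
proof -
  have "preimage s {w. shift w \<in> E} = (\<Union>d<3. preimage s {w. w 0 = d \<and> shift w \<in> E})"
    using block_less by (auto simp: preimage_def)
  also have "\<dots> = (\<Union>d<3. branch d (preimage (if d = 1 then \<not> s else s) E))"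
    by (intro SUP_cong refl preimage_branch) simp
  finally show ?thesis .
qed

text \<open>Discarding the first code word lowers the coordinate by 1 and exhibits the preimage as a
  union of three sets obtained from Borel sets by affine maps.\<close>

lemma preimage_coordinate_borel: "preimage s {w. w n = d} \<in> sets borel"
proof (induction n arbitrary: s)
  case 0
  show ?case
  proof (cases "d < 3")
    case True
    have "preimage s' UNIV = dom_of s'" for s' by (simp add: preimage_def)
    then show ?thesis using preimage_branch[OF True, of s UNIV] branch_borel[OF dom_of_borel] by simp
  next
    case False
    then have "preimage s {w. w 0 = d} = {}" using block_less by (auto simp: preimage_def)
    then show ?thesis by simp
  qed
next
  case (Suc n)
  have "preimage s {w. w (Suc n) = d} = preimage s {w. shift w \<in> {w. w n = d}}"
    by (simp add: shift_def)
  then show ?case unfolding preimage_UN_branch using Suc branch_borel by auto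
qed

lemma parse_expansion_measurable:
  "(\<lambda>x. parse (expansion s x)) \<in> restrict_space borel (dom_of s) \<rightarrow>\<^sub>M borel"
proof (rule measurable_coordinatewise_then_product)
  fix n
  have "(\<lambda>x. parse (expansion s x) n) \<in> restrict_space borel (dom_of s) \<rightarrow>\<^sub>M count_space UNIV"
  proof (subst measurable_count_space_eq2_countable; safe?)
    fix d
    have "(\<lambda>x. parse (expansion s x) n) -` {d} \<inter> space (restrict_space borel (dom_of s))
        = preimage s {w. w n = d}"
      by (auto simp: preimage_def space_restrict_space)
    then show "(\<lambda>x. parse (expansion s x) n) -` {d} \<inter> space (restrict_space borel (dom_of s))
        \<in> sets (restrict_space borel (dom_of s))"
      using preimage_coordinate_borel by (simp add: sets_restrict_space_iff preimage_def)
  qed (auto)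
  then show "(\<lambda>x. parse (expansion s x) n) \<in> restrict_space borel (dom_of s) \<rightarrow>\<^sub>M borel"
    by (simp add: measurable_cong_sets[OF refl sets_borel_eq_count_space])
qed

section \<open>Self-similar measures\<close>

lemma space_borel_Omega: "space (borel_Omega r) = Omega r"
  by (simp add: borel_Omega_def space_restrict_space)

lemma cylinder_sets: "cylinder r w \<in> sets (borel_Omega r)"
proof -
  have c: "(\<lambda>\<omega>. \<omega> i) -` {d} \<in> sets borel" for i d :: nat
    by (intro borel_open open_vimage[OF Topological_Spaces.open_discrete continuous_on_product_coordinates])
  have "(\<Inter>i\<in>{..<length w}. (\<lambda>\<omega>. \<omega> i) -` {w ! i}) \<in> sets (borel :: (nat \<Rightarrow> nat) measure)"
  proof (cases "w = []")
    case False
    then show ?thesis using c by (intro sets.finite_INT) auto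
  qed simp
  moreover have "cylinder r w = Omega r \<inter> (\<Inter>i\<in>{..<length w}. (\<lambda>\<omega>. \<omega> i) -` {w ! i})"
    by (auto simp: cylinder_def)
  ultimately show ?thesis unfolding borel_Omega_def sets_restrict_space by blast
qed

text \<open>Isolating the functional equation and the support lets the same argument serve
  \<open>mu_star\<close> and its reflection, where p and q are exchanged.\<close>

locale self_similar = prob_space M for M :: "real measure" +
  fixes p q :: real
  assumes p_pos: "0 < p" and q_pos: "0 < q" and pq: "p + q = 1"
    and sets_M [simp, measurable_cong]: "sets M = sets borel"
    and unit: "AE x in M. 0 \<le> x \<and> x \<le> 1"
    and self_similar: "A \<in> sets borel \<Longrightarrow>
      prob A = p * prob {y. 1 - y / beta \<in> A} + q * prob {y. (1 - y) / beta \<in> A}"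
begin

lemma space_M [simp]: "space M = UNIV"
  using sets_eq_imp_space_eq[OF sets_M] by simp

lemma prob_outside:
  assumes "x < 0 \<or> 1 < x"
  shows "prob {x} = 0"
proof -
  have "prob {x} = prob {}"
  proof (rule finite_measure_eq_AE)
    show "AE y in M. y \<in> {x} \<longleftrightarrow> y \<in> {}"
      using unit by eventually_elim (use assms in auto)
  qed simp_all
  then show ?thesis by simp
qed

text \<open>All other preimages lying outside the unit interval, the mass of 0 is q times that of 1
  and the mass of 1 is p times that of 0. As p * q < 1, both vanish, so open and half-open unit
  intervals have the same mass.\<close>

lemma open_unit: "AE x in M. 0 < x \<and> x < 1"
proof -
  have "prob {0} = p * prob {beta} + q * prob {1}"
    using self_similar[of "{0}"] beta_gt_1 by (simp add: field_simps eq_commute)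
  also have "prob {beta} = 0" using beta_gt_1 by (intro prob_outside) simp
  finally have 0: "prob {0} = q * prob {1}" by simp
  have "{y. (1 - y) / beta = 1} = {1 - beta}" using beta_gt_1 by (auto simp: field_simps)
  moreover have "{y. 1 - y / beta = 1} = {0}" using beta_gt_1 by auto
  ultimately have "prob {1} = p * prob {0} + q * prob {1 - beta}"
    using self_similar[of "{1}"] by simp
  also have "prob {1 - beta} = 0" using beta_gt_1 by (intro prob_outside) simp
  finally have 1: "prob {1} = p * prob {0}" by simp
  have "p * q < 1" using p_pos q_pos pq mult_strict_mono[of p 1 q 1] by simp
  moreover have "prob {0} * (1 - p * q) = 0" using 0 1 by (simp add: algebra_simps)
  ultimately have "prob {0} = 0" "prob {1} = 0" using 1 by auto
  then have "{0} \<in> null_sets M" "{1} \<in> null_sets M"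
    by (simp_all add: null_sets_def emeasure_eq_measure)
  then have "AE x in M. x \<notin> {0}" "AE x in M. x \<notin> {1}" by (simp_all only: AE_not_in)
  then show ?thesis using unit by eventually_elim auto
qed

lemma prob_cong:
  assumes "A \<in> sets borel" "B \<in> sets borel" "\<And>x. 0 < x \<Longrightarrow> x < 1 \<Longrightarrow> x \<in> A \<longleftrightarrow> x \<in> B"
  shows "prob A = prob B"
proof (rule finite_measure_eq_AE)
  show "AE x in M. x \<in> A \<longleftrightarrow> x \<in> B" using open_unit by eventually_elim (use assms in auto)
qed (use assms in simp_all)

text \<open>The shifts \<open>0\<close>, \<open>\<beta> - 1 = 1/\<beta>\<close> and \<open>\<beta> - 2 = -1/\<beta>\<^sup>2\<close> are closed under the code words:
  refining a subset of the unit interval by the self-similarity never produces other shifts of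
  positive measure.\<close>

definition translate :: "real \<Rightarrow> real set \<Rightarrow> real" where
  "translate s B = prob {x. x + s \<in> B}"

text \<open>Dividing the third coordinate by p / q balances the matrices: apart from the scalar
  \<open>weight\<close>, they then depend on p / q alone.\<close>

definition translates :: "real set \<Rightarrow> real \<times> real \<times> real" where
  "translates B = (translate 0 B, translate (beta - 1) B, translate (beta - 2) B / (p / q))"

lemma borel_translate [measurable]: "B \<in> sets borel \<Longrightarrow> {x::real. x + s \<in> B} \<in> sets borel"
  using measurable_sets[of "\<lambda>x. x + s" borel borel B] by (simp add: vimage_def)

lemma translate_far:
  assumes "B \<in> sets borel" "B \<subseteq> {0..1}" "1 \<le> \<bar>s\<bar>"
  shows "translate s B = 0"
proof -
  have "translate s B = prob {}"
    unfolding translate_def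
  proof (intro prob_cong borel_translate assms)
    fix x :: real assume "0 < x" "x < 1"
    then have "x + s \<notin> {0..1}" using assms(3) by auto
    then show "x \<in> {x. x + s \<in> B} \<longleftrightarrow> x \<in> {}" using assms(2) by auto
  qed simp
  then show ?thesis by simp
qed

text \<open>The expanding map of the digit 0 cancels the contraction of either branch and leaves a
  translation: s becomes - \<open>beta\<close> * s under the branch of the digit 0, with an extra
  \<open>beta\<close> - 1 under that of the digit 1.\<close>

lemma translate_image0:
  assumes "B \<in> sets borel"
  shows "translate s (image0 B) = p * translate (- beta * s) B + q * translate (beta - 1 - beta * s) B"
proof -
  have "translate s (image0 B) = p * prob {y. beta * (1 - (1 - y / beta + s)) \<in> B}
      + q * prob {y. beta * (1 - ((1 - y) / beta + s)) \<in> B}"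
    unfolding translate_def using self_similar[OF borel_translate[OF image0_borel[OF assms], of s]]
    by (simp add: image0_def)
  moreover have "beta * (1 - (1 - y / beta + s)) = y + - beta * s"
    "beta * (1 - ((1 - y) / beta + s)) = y + (beta - 1 - beta * s)" for y
    using beta_gt_1 by (simp_all add: field_simps)
  ultimately show ?thesis by (simp only: translate_def)
qed

lemma translate_image1:
  assumes "B \<in> sets borel"
  shows "translate s (image1 B) = p * translate (1 - beta - beta * s) B + q * translate (- beta * s) B"
proof -
  have "translate s (image1 B) = p * prob {y. 1 - beta * (1 - y / beta + s) \<in> B}
      + q * prob {y. 1 - beta * ((1 - y) / beta + s) \<in> B}"
    unfolding translate_def using self_similar[OF borel_translate[OF image1_borel[OF assms], of s]]
    by (simp add: image1_def)
  moreover have "1 - beta * (1 - y / beta + s) = y + (1 - beta - beta * s)"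
    "1 - beta * ((1 - y) / beta + s) = y + - beta * s" for y
    using beta_gt_1 by (simp_all add: field_simps)
  ultimately show ?thesis by (simp only: translate_def)
qed

lemma image0_unit: "B \<subseteq> {0..1} \<Longrightarrow> image0 B \<subseteq> {0..1}"
proof
  fix x assume "B \<subseteq> {0..1}" "x \<in> image0 B"
  then have "0 \<le> beta * (1 - x)" "beta * (1 - x) \<le> 1" by (auto simp: image0_def)
  moreover from this(1) have "0 \<le> 1 - x" using beta_gt_1 by (simp add: zero_le_mult_iff)
  moreover from this have "1 * (1 - x) \<le> beta * (1 - x)" using beta_gt_1 by (intro mult_right_mono) auto
  ultimately show "x \<in> {0..1}" by auto
qed

lemma image1_unit: "B \<subseteq> {0..1} \<Longrightarrow> image1 B \<subseteq> {0..1}"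
proof
  fix x assume "B \<subseteq> {0..1}" "x \<in> image1 B"
  then have "0 \<le> beta * x" "beta * x \<le> 1" by (auto simp: image1_def)
  moreover from this(1) have "0 \<le> x" using beta_gt_1 by (simp add: zero_le_mult_iff)
  moreover from this have "1 * x \<le> beta * x" using beta_gt_1 by (intro mult_right_mono) auto
  ultimately show "x \<in> {0..1}" by auto
qed

lemma branch_unit: "B \<subseteq> {0..1} \<Longrightarrow> branch d B \<subseteq> {0..1}"
  by (simp add: branch_def image0_unit image1_unit)

text \<open>Displacements of modulus at least 1 contribute nothing, and \<open>beta_squared\<close>
  turns the others back into those of \<open>translates\<close>. The displacement 1 -
  \<open>beta\<close>, which \<open>image1\<close> produces, vanishes on an image under
  \<open>image0\<close>; it never survives in a code word, where each 1 is followed by 0.\<close>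

lemma translates_image0:
  assumes B: "B \<in> sets borel" "B \<subseteq> {0..1}"
  shows "translate 0 (image0 B) = p * translate 0 B + q * translate (beta - 1) B"
    "translate (beta - 1) (image0 B) = q * translate (beta - 2) B"
    "translate (beta - 2) (image0 B) = p * translate (beta - 1) B"
    "translate (1 - beta) (image0 B) = 0"
proof -
  note far = translate_far[OF B] and b = beta_gt_1 beta_lt_2 beta_squared
  have e: "- beta * (beta - 1) = - 1" "beta - 1 - beta * (beta - 1) = beta - 2"
    "- beta * (beta - 2) = beta - 1" "beta - 1 - beta * (beta - 2) = 2 * (beta - 1)"
    "- beta * (1 - beta) = 1" "beta - 1 - beta * (1 - beta) = beta"
    using b(3) by algebra+
  \<comment> \<open>Follows from sqrt 5 >= 2 and makes the displacement 2 * (\<open>beta\<close> -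
    1) at least 1.\<close>
  have "3 \<le> beta * 2"
    using real_le_rsqrt[of 2 5] by (simp add: beta_def)
  then have "translate (2 * (beta - 1)) B = 0" using b by (intro far) simp
  then show "translate 0 (image0 B) = p * translate 0 B + q * translate (beta - 1) B"
    "translate (beta - 1) (image0 B) = q * translate (beta - 2) B"
    "translate (beta - 2) (image0 B) = p * translate (beta - 1) B"
    "translate (1 - beta) (image0 B) = 0"
    unfolding translate_image0[OF B(1)] e using far b by simp_all
qed

lemma translates_image1:
  assumes B: "B \<in> sets borel" "B \<subseteq> {0..1}"
  shows "translate 0 (image1 B) = p * translate (1 - beta) B + q * translate 0 B"
    "translate (beta - 1) (image1 B) = 0"
    "translate (beta - 2) (image1 B) = p * translate 0 B + q * translate (beta - 1) B"
proof -
  note far = translate_far[OF B] and b = beta_gt_1 beta_lt_2 beta_squared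
  have e: "1 - beta - beta * (beta - 1) = - beta" "- beta * (beta - 1) = - 1"
    "1 - beta - beta * (beta - 2) = 0" "- beta * (beta - 2) = beta - 1"
    using b(3) by algebra+
  show "translate 0 (image1 B) = p * translate (1 - beta) B + q * translate 0 B"
    "translate (beta - 1) (image1 B) = 0"
    "translate (beta - 2) (image1 B) = p * translate 0 B + q * translate (beta - 1) B"
    unfolding translate_image1[OF B(1)] e using far b by simp_all
qed

definition weight :: "nat \<Rightarrow> real" where
  "weight d = (if d = 0 then p * q else if d = 1 then p * q * q else q * q)"

lemma translates_branch:
  assumes B: "B \<in> sets borel" "B \<subseteq> {0..1}"
  shows "translates (branch d B) = weight d *\<^sub>R step (p / q) d (translates B)"
proof -
  note B0 = image0_borel[OF B(1)] image0_unit[OF B(2)]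
  note B00 = image0_borel[OF B0(1)] image0_unit[OF B0(2)]
  note B10 = image1_borel[OF B0(1)] image1_unit[OF B0(2)]
  note t = translates_image0[OF B] translates_image0[OF B0] translates_image1[OF B0] translates_image0[OF B10]
  have nz: "p \<noteq> 0" "q \<noteq> 0" using p_pos q_pos by auto
  consider (0) "d = 0" | (1) "d = 1" | (2) "d \<noteq> 0" "d \<noteq> 1" by blast
  then show ?thesis
    by cases (simp_all add: translates_def branch_def weight_def step_def t nz field_simps)
qed

text \<open>Up to endpoints, the displacement \<open>beta\<close> - 1 selects the points below
  \<open>1 / beta\<^sup>2\<close>, the image of the interval under the word 10; the transfer
  relations give u = q * (p + q * u), so u = q / (1 + q). The displacement \<open>beta\<close> - 2
  selects the complement, of mass 1 / (1 + q).\<close>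

lemma translates_dom:
  obtains x z where "\<And>s. translates (dom_of s) = (1, x, z)" "0 \<le> x" "x \<le> 1" "0 \<le> z" "z \<le> q / p"
proof -
  have "translates (dom_of s) = (1, q / (1 + q), 1 / (1 + q) / (p / q))" for s
  proof -
    let ?u = "translate (beta - 1) (dom_of s)" and ?c = "translate (beta - 2) (dom_of s)"
    have D: "dom_of s \<in> sets borel" "dom_of s \<subseteq> {0..1}" using dom_of_unit by auto
    note D0 = image0_borel[OF D(1)] image0_unit[OF D(2)]
    have a: "translate 0 (dom_of s) = 1"
    proof -
      have "translate 0 (dom_of s) = prob UNIV"
        unfolding translate_def by (intro prob_cong borel_translate D) (auto simp: dom_of_def)
      then show ?thesis using prob_space by simp
    qed
    have "?u = translate 0 (image1 (image0 (dom_of s)))"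
      unfolding translate_def
    proof (intro prob_cong borel_translate image1_borel D0 D)
      fix x :: real assume x: "0 < x" "x < 1"
      have "x + (beta - 1) \<in> dom_of s \<longleftrightarrow> x < 2 - beta \<or> \<not> s \<and> x = 2 - beta"
        using x beta_gt_1 by (auto simp: dom_of_def)
      moreover have "x + 0 \<in> image1 (image0 (dom_of s)) \<longleftrightarrow> beta\<^sup>2 * x \<in> dom_of s"
        by (simp add: image0_def image1_def power2_eq_square mult.assoc)
      moreover have "beta\<^sup>2 * x < 1 \<longleftrightarrow> x < 2 - beta" "beta\<^sup>2 * x = 1 \<longleftrightarrow> x = 2 - beta"
        using beta_gt_1 by (auto simp: inverse_beta_squared[symmetric] field_simps)
      moreover have "0 < beta\<^sup>2 * x" using x beta_gt_1 by simp
      ultimately show "x \<in> {x. x + (beta - 1) \<in> dom_of s} \<longleftrightarrow> x \<in> {x. x + 0 \<in> image1 (image0 (dom_of s))}"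
        by (auto simp: dom_of_def)
    qed
    then have "?u = q * (p + q * ?u)"
      using translates_image1(1)[OF D0] translates_image0[OF D] a by simp
    \<comment> \<open>With p = 1 - q the equation for \<open>?u\<close> acquires the common factor 1
      - q.\<close>
    then have "(1 - q) * ((1 + q) * ?u - q) = 0" using pq by algebra
    then have "(1 + q) * ?u = q" using p_pos pq by simp
    then have u: "?u = q / (1 + q)" using q_pos by (simp add: field_simps)
    have "?u + ?c = prob ({x. x + (beta - 1) \<in> dom_of s} \<union> {x. x + (beta - 2) \<in> dom_of s})"
      unfolding translate_def using D beta_gt_1
      by (subst finite_measure_Union) (auto simp: dom_of_def split: if_splits)
    also have "\<dots> = prob UNIV"
      using D beta_gt_1 beta_lt_2 by (intro prob_cong sets.Un borel_translate) (auto simp: dom_of_def)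
    finally have "?c = 1 / (1 + q)" using u prob_space q_pos by (simp add: field_simps)
    then show ?thesis using a u by (simp add: translates_def)
  qed
  moreover have "1 / (1 + q) / (p / q) \<le> 1 / (p / q)"
    using p_pos q_pos by (intro divide_right_mono) auto
  then have "1 / (1 + q) / (p / q) \<le> q / p" by simp
  moreover have "0 \<le> q / (1 + q)" "q / (1 + q) \<le> 1" "0 \<le> 1 / (1 + q) / (p / q)"
    using p_pos q_pos by auto
  ultimately show ?thesis using that by blast
qed

text \<open>The induction covers both orientations because the digit 1 switches them; they share one
  start vector, since their half-open intervals differ only in endpoints of mass 0.\<close>

lemma preimage_cylinder:
  "set w \<subseteq> {..<3} \<Longrightarrow>
    preimage s (cylinder 3 w) \<in> sets borel \<and> preimage s (cylinder 3 w) \<subseteq> {0..1} \<and>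
    translates (preimage s (cylinder 3 w)) = (\<Prod>d\<leftarrow>w. weight d) *\<^sub>R steps (p / q) w (translates (dom_of True))"
proof (induction w arbitrary: s)
  case Nil
  have "translates (dom_of s) = translates (dom_of True)" using translates_dom by metis
  moreover have "dom_of s \<subseteq> {0..1}" using dom_of_unit by auto
  ultimately show ?case unfolding preimage_cylinder_Nil by simp
next
  case (Cons d w)
  then have d: "d < 3" and IH: "\<And>s. preimage s (cylinder 3 w) \<in> sets borel"
    "\<And>s. preimage s (cylinder 3 w) \<subseteq> {0..1}"
    "\<And>s. translates (preimage s (cylinder 3 w)) = (\<Prod>d\<leftarrow>w. weight d) *\<^sub>R steps (p / q) w (translates (dom_of True))"
    by auto
  show ?case
    unfolding preimage_cylinder_Cons[OF d] translates_branch[OF IH(1,2)] IH(3) linear_scale[OF linear_step]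
    using branch_borel[OF IH(1)] branch_unit[OF IH(2)] by simp
qed

lemma prob_preimage_cylinder:
  assumes "set w \<subseteq> {..<3}"
  shows "prob (preimage s (cylinder 3 w)) = (\<Prod>d\<leftarrow>w. weight d) * fst (steps (p / q) w (translates (dom_of True)))"
proof -
  have "prob (preimage s (cylinder 3 w)) = fst (translates (preimage s (cylinder 3 w)))"
    by (simp add: translates_def translate_def)
  then show ?thesis using preimage_cylinder[OF assms, of s] by simp
qed

section \<open>From cylinder masses to the coded measure\<close>

lemma xi_star_measurable: "xi_star \<in> restrict_space M {0..<1} \<rightarrow>\<^sub>M borel_Omega 3"
proof -
  have "(\<lambda>x. parse (expansion True x)) \<in> restrict_space borel {0..<1} \<rightarrow>\<^sub>M borel"
    using parse_expansion_measurable[of True] by (simp add: dom_of_def)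
  then have "(\<lambda>x. parse (expansion True x)) \<in> restrict_space borel {0..<1} \<rightarrow>\<^sub>M borel_Omega 3"
    unfolding borel_Omega_def by (rule measurable_restrict_space2[rotated]) (simp add: parse_Omega)
  then have "(\<lambda>x. parse (expansion True x)) \<in> restrict_space M {0..<1} \<rightarrow>\<^sub>M borel_Omega 3"
    by (subst measurable_cong_sets[OF sets_restrict_space_cong[OF sets_M] refl])
  then show ?thesis
    by (subst measurable_cong) (auto simp: space_restrict_space xi_star_eq_parse)
qed

text \<open>Recognising the set function as that of an image measure secures countable additivity,
  so \<open>measure_of\<close> does not fall back to the null measure.\<close>

lemma distr_xi_star:
  "measure_of (Omega 3) (sets (borel_Omega 3)) (\<lambda>E. emeasure M (xi_star_preimage E))
     = distr (restrict_space M {0..<1}) (borel_Omega 3) xi_star"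
  unfolding distr_def space_borel_Omega
proof (rule measure_of_eq)
  show "sets (borel_Omega 3) \<subseteq> Pow (Omega 3)"
    using sets.space_closed[of "borel_Omega 3"] by (simp add: space_borel_Omega)
  fix E assume "E \<in> sigma_sets (Omega 3) (sets (borel_Omega 3))"
  then have E: "E \<in> sets (borel_Omega 3)"
    using sets.sigma_sets_eq[of "borel_Omega 3"] by (simp add: space_borel_Omega)
  have eq: "xi_star -` E \<inter> space (restrict_space M {0..<1}) = xi_star_preimage E"
    by (auto simp: xi_star_preimage_def space_restrict_space)
  then show "emeasure M (xi_star_preimage E)
      = emeasure (restrict_space M {0..<1}) (xi_star -` E \<inter> space (restrict_space M {0..<1}))"
    unfolding eq by (subst emeasure_restrict_space) (auto simp: xi_star_preimage_def)
qed

lemma weak_gibbs_distr: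
  assumes "q \<le> p"
  shows "weak_gibbs 3 (measure_of (Omega 3) (sets (borel_Omega 3)) (\<lambda>E. emeasure M (xi_star_preimage E)))"
  unfolding distr_xi_star
proof -
  let ?R = "restrict_space M {0..<1}" and ?m = "distr (restrict_space M {0..<1}) (borel_Omega 3) xi_star"
  have "prob {0..<1} = prob UNIV" by (rule prob_cong) auto
  then have "emeasure M {0..<1} = 1" using prob_space by (simp add: emeasure_eq_measure)
  then have "prob_space ?R"
    by (intro prob_spaceI) (simp add: space_restrict_space emeasure_restrict_space)
  then have "prob_space ?m" using xi_star_measurable by (rule prob_space.prob_space_distr)
  moreover obtain x z where v: "translates (dom_of True) = (1, x, z)" "0 \<le> x" "x \<le> 1" "0 \<le> z" "z \<le> q / p"
    using translates_dom by metis
  \<comment> \<open>The assumption p >= q enters twice: here it bounds the start vector, and below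
    it yields p / q >= 1.\<close>
  have "q / p \<le> 1" using assms p_pos by simp
  then have "nonneg3 (translates (dom_of True))" "fst (translates (dom_of True)) = 1" "dominated 1 (translates (dom_of True))"
    using v by (auto simp: nonneg3_def dominated_def)
  moreover have "measure ?m (cylinder 3 (map \<omega> [0..<n]))
      = (\<Prod>k<n. weight (\<omega> k)) * fst (steps (p / q) (map \<omega> [0..<n]) (translates (dom_of True)))"
    if "\<omega> \<in> Omega 3" for \<omega> n
  proof -
    let ?w = "map \<omega> [0..<n]"
    have w: "set ?w \<subseteq> {..<3}" using that by (auto simp: Omega_def)
    have "xi_star -` cylinder 3 ?w \<inter> space ?R = preimage True (cylinder 3 ?w)"
      by (auto simp: preimage_def dom_of_def space_restrict_space xi_star_eq_parse)
    then have "measure ?m (cylinder 3 ?w) = measure ?R (preimage True (cylinder 3 ?w))"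
      using measure_distr[OF xi_star_measurable cylinder_sets, of ?w] by simp
    also have "\<dots> = prob (preimage True (cylinder 3 ?w))"
      by (rule measure_restrict_space) (auto simp: preimage_def dom_of_def)
    also have "\<dots> = (\<Prod>d\<leftarrow>?w. weight d) * fst (steps (p / q) ?w (translates (dom_of True)))"
      by (rule prob_preimage_cylinder[OF w])
    also have "(\<Prod>d\<leftarrow>?w. weight d) = (\<Prod>k<n. weight (\<omega> k))"
      by (simp add: o_def prod.list_conv_set_nth atLeast0LessThan)
    finally show ?thesis .
  qed
  moreover have "1 \<le> p / q" using assms q_pos by simp
  moreover have "0 < weight d" for d using p_pos q_pos by (simp add: weight_def)
  ultimately show "weak_gibbs 3 ?m"
    by (intro weak_gibbs_steps[where c = weight and r = "p / q" and v = "translates (dom_of True)"]) simp_all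
qed

end

section \<open>The Bernoulli measure and its image under \<open>Y\<close>\<close>

lemma
  fixes p q :: real
  assumes "0 < p" "0 < q" "p + q = 1"
  shows bernoulli_prob_space: "prob_space (bernoulli_measure p q)"
    and space_bernoulli: "space (bernoulli_measure p q) = Omega 2"
    and bernoulli_split: "E \<in> sets (bernoulli_measure p q) \<Longrightarrow>
      measure (bernoulli_measure p q) E
        = p * measure (bernoulli_measure p q) {\<omega> \<in> Omega 2. case_nat 0 \<omega> \<in> E}
          + q * measure (bernoulli_measure p q) {\<omega> \<in> Omega 2. case_nat 1 \<omega> \<in> E}"
    and Y_measurable: "Y \<in> borel_measurable (bernoulli_measure p q)"
proof -
  let ?f = "\<lambda>d::nat. ennreal (if d = 0 then p else q)"
  let ?B = "point_measure {0, 1} ?f"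
  let ?N = "bernoulli_measure p q"
  have N: "?N = (\<Pi>\<^sub>M n\<in>UNIV. ?B)" by (simp add: bernoulli_measure_def)
  have "emeasure ?B {0, 1} = ennreal p + ennreal q"
    by (subst emeasure_point_measure_finite) auto
  also have "\<dots> = 1" using assms by (simp flip: ennreal_plus)
  finally interpret B: prob_space ?B
    by (intro prob_spaceI) (simp add: space_point_measure)
  interpret sequence_space ?B
    by unfold_locales
  show P: "prob_space ?N" unfolding N by unfold_locales
  then interpret N: prob_space ?N .
  show space: "space ?N = Omega 2"
    by (auto simp: N space_PiM space_point_measure Omega_def PiE_def Pi_def less_2_cases_iff)
  have "(\<lambda>\<omega>. real (\<omega> n)) \<in> borel_measurable ?N" for n
    unfolding N
    by (rule measurable_compose[OF measurable_component_singleton])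
      (simp_all add: measurable_point_measure_eq1)
  then show "Y \<in> borel_measurable ?N" unfolding Y_def by measurable
  assume E: "E \<in> sets ?N"
  let ?c = "\<lambda>(s, \<omega>). case_nat s \<omega> :: nat \<Rightarrow> nat"
  have c: "?c \<in> ?B \<Otimes>\<^sub>M ?N \<rightarrow>\<^sub>M ?N" unfolding N by measurable
  have vim: "?c -` E \<inter> space (?B \<Otimes>\<^sub>M ?N) \<in> sets (?B \<Otimes>\<^sub>M ?N)"
    using measurable_sets[OF c E] .
  \<comment> \<open>By \<open>PiM_iter\<close> the sequence space is one coin toss times itself,
    with the toss prepended; integrating over the toss last gives the two terms.\<close>
  have "emeasure ?N E = emeasure (distr (?B \<Otimes>\<^sub>M ?N) ?N ?c) E"
    unfolding N PiM_iter ..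
  also have "\<dots> = emeasure (?B \<Otimes>\<^sub>M ?N) (?c -` E \<inter> space (?B \<Otimes>\<^sub>M ?N))"
    by (rule emeasure_distr[OF c E])
  also have "\<dots> = (\<integral>\<^sup>+ s. emeasure ?N (Pair s -` (?c -` E \<inter> space (?B \<Otimes>\<^sub>M ?N))) \<partial>?B)"
    by (rule N.emeasure_pair_measure_alt[OF vim])
  also have "\<dots> = (\<integral>\<^sup>+ s. emeasure ?N {\<omega> \<in> Omega 2. case_nat s \<omega> \<in> E} \<partial>?B)"
    by (intro nn_integral_cong arg_cong[where f = "emeasure ?N"])
      (auto simp: space_pair_measure space)
  also have "\<dots> = (\<Sum>s\<in>{0, 1}. ?f s * emeasure ?N {\<omega> \<in> Omega 2. case_nat s \<omega> \<in> E})"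
    by (subst nn_integral_point_measure_finite) simp_all
  also have "\<dots> = ennreal p * emeasure ?N {\<omega> \<in> Omega 2. case_nat 0 \<omega> \<in> E}
      + ennreal q * emeasure ?N {\<omega> \<in> Omega 2. case_nat 1 \<omega> \<in> E}" by simp
  finally show "measure ?N E = p * measure ?N {\<omega> \<in> Omega 2. case_nat 0 \<omega> \<in> E}
          + q * measure ?N {\<omega> \<in> Omega 2. case_nat 1 \<omega> \<in> E}"
    using assms by (simp add: N.emeasure_eq_measure flip: ennreal_mult ennreal_plus)
qed

text \<open>Conditioning on the first digit turns \<open>Y_rec\<close> into the functional
  equation.\<close>

lemma self_similar_mu_star:
  assumes "0 < p" "0 < q" "p + q = 1"
  shows "self_similar (mu_star p q) p q"
proof -
  let ?N = "bernoulli_measure p q"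
  note N = bernoulli_prob_space[OF assms] space_bernoulli[OF assms]
  note Y [measurable] = Y_measurable[OF assms]
  interpret N: prob_space ?N by (rule N)
  interpret M: prob_space "mu_star p q" unfolding mu_star_def by (rule N.prob_space_distr[OF Y])
  have M: "measure (mu_star p q) A = measure ?N {\<omega> \<in> Omega 2. Y \<omega> \<in> A}" if "A \<in> sets borel" for A
    using that unfolding mu_star_def
    by (subst measure_distr[OF Y]) (auto simp: N(2) vimage_def Int_def conj_commute)
  have cons: "case_nat d \<omega> \<in> Omega 2 \<and> Y (case_nat d \<omega>) = (if d = 0 then 1 - Y \<omega> / beta else (1 - Y \<omega>) / beta)"
    if "\<omega> \<in> Omega 2" "d < 2" for d \<omega>
  proof -
    have O: "case_nat d \<omega> \<in> Omega 2" using that by (auto simp: Omega_def split: nat.split)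
    have "shift (case_nat d \<omega>) = \<omega>" by (simp add: shift_def)
    with Y_rec[OF O] show ?thesis using O by (simp only:) simp
  qed
  show ?thesis
  proof
    show "0 < p" "0 < q" "p + q = 1" using assms by auto
    show "sets (mu_star p q) = sets borel" by (simp add: mu_star_def)
    show "AE x in mu_star p q. 0 \<le> x \<and> x \<le> 1"
      unfolding mu_star_def using Y_range
      by (subst AE_distr_iff[OF Y]) (auto simp: N(2) intro!: AE_I2)
    fix A :: "real set" assume A: "A \<in> sets borel"
    have 0: "{y. 1 - y / beta \<in> A} \<in> sets borel"
      using measurable_sets[of "\<lambda>y. 1 - y / beta" borel borel A] A by (simp add: vimage_def)
    have 1: "{y. (1 - y) / beta \<in> A} \<in> sets borel"
      using measurable_sets[of "\<lambda>y. (1 - y) / beta" borel borel A] A by (simp add: vimage_def)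
    have "{\<omega> \<in> Omega 2. Y \<omega> \<in> A} = Y -` A \<inter> space ?N" by (auto simp: N(2))
    then have E: "{\<omega> \<in> Omega 2. Y \<omega> \<in> A} \<in> sets ?N" using measurable_sets[OF Y A] by simp
    have "{\<omega> \<in> Omega 2. case_nat 0 \<omega> \<in> {\<omega> \<in> Omega 2. Y \<omega> \<in> A}} = {\<omega> \<in> Omega 2. Y \<omega> \<in> {y. 1 - y / beta \<in> A}}"
      "{\<omega> \<in> Omega 2. case_nat 1 \<omega> \<in> {\<omega> \<in> Omega 2. Y \<omega> \<in> A}} = {\<omega> \<in> Omega 2. Y \<omega> \<in> {y. (1 - y) / beta \<in> A}}"
      by (simp_all add: cons cong: conj_cong)
    then show "measure (mu_star p q) A = p * measure (mu_star p q) {y. 1 - y / beta \<in> A}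
        + q * measure (mu_star p q) {y. (1 - y) / beta \<in> A}"
      unfolding M[OF A] M[OF 0] M[OF 1] bernoulli_split[OF assms E] by simp
  qed
qed

text \<open>The reflection \<open>S\<close> exchanges the two branches, hence the roles of \<open>p\<close> and \<open>q\<close>.\<close>

lemma self_similar_distr_S:
  assumes "self_similar M p q"
  shows "self_similar (distr M borel S) q p"
proof -
  interpret self_similar M p q by fact
  have S [measurable]: "S \<in> borel_measurable M" unfolding S_def by measurable
  interpret D: prob_space "distr M borel S" by (rule prob_space_distr[OF S])
  have D: "measure (distr M borel S) A = prob {x. 1 - x \<in> A}" if "A \<in> sets borel" for A
    using that by (subst measure_distr[OF S]) (auto simp: vimage_def S_def)
  show ?thesis
  proof
    show "0 < q" "0 < p" "q + p = 1" using p_pos q_pos pq by auto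
    show "sets (distr M borel S) = sets borel" by simp
    show "AE x in distr M borel S. 0 \<le> x \<and> x \<le> 1"
      using unit by (subst AE_distr_iff[OF S]) (auto simp: S_def elim!: eventually_mono)
    fix A :: "real set" assume A: "A \<in> sets borel"
    have 0: "{y. 1 - y / beta \<in> A} \<in> sets borel"
      using measurable_sets[of "\<lambda>y. 1 - y / beta" borel borel A] A by (simp add: vimage_def)
    have 1: "{y. (1 - y) / beta \<in> A} \<in> sets borel"
      using measurable_sets[of "\<lambda>y. (1 - y) / beta" borel borel A] A by (simp add: vimage_def)
    have 2: "{x. 1 - x \<in> A} \<in> sets borel"
      using measurable_sets[of "\<lambda>x. 1 - x" borel borel A] A by (simp add: vimage_def)
    have "1 - (1 - y / beta) = (1 - (1 - y)) / beta" "1 - (1 - y) / beta = 1 - (1 - (1 - (1 - y) / beta))" for y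
      by simp_all
    then show "measure (distr M borel S) A = q * measure (distr M borel S) {y. 1 - y / beta \<in> A}
        + p * measure (distr M borel S) {y. (1 - y) / beta \<in> A}"
      unfolding D[OF A] D[OF 0] D[OF 1] self_similar[OF 2] by simp
  qed
qed

theorem theorem7p1:
  fixes p q :: real
  assumes "p > 0" and "q > 0" and "p + q = 1"
  shows "(p \<ge> q \<longrightarrow> weak_gibbs 3 (mu_xi p q)) \<and>
         (p \<le> q \<longrightarrow> weak_gibbs 3 (mu_S_xi p q))"
proof (intro conjI impI)
  interpret M: self_similar "mu_star p q" p q by (rule self_similar_mu_star[OF assms])
  show "weak_gibbs 3 (mu_xi p q)" if "p \<ge> q"
    unfolding mu_xi_def by (rule M.weak_gibbs_distr[OF that])
  interpret D: self_similar "distr (mu_star p q) borel S" q p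
    by (rule self_similar_distr_S) unfold_locales
  have "mu_S_xi p q = measure_of (Omega 3) (sets (borel_Omega 3))
      (\<lambda>E. emeasure (distr (mu_star p q) borel S) (xi_star_preimage E))"
    unfolding mu_S_xi_def
  proof (rule measure_of_eq)
    show "sets (borel_Omega 3) \<subseteq> Pow (Omega 3)"
      using sets.space_closed[of "borel_Omega 3"] by (simp add: space_borel_Omega)
    fix E assume "E \<in> sigma_sets (Omega 3) (sets (borel_Omega 3))"
    then have E: "E \<in> sets (borel_Omega 3)"
      using sets.sigma_sets_eq[of "borel_Omega 3"] by (simp add: space_borel_Omega)
    have "xi_star -` E \<inter> space (restrict_space (mu_star p q) {0..<1}) = xi_star_preimage E"
      by (auto simp: xi_star_preimage_def space_restrict_space)
    then have "xi_star_preimage E \<in> sets borel"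
      using measurable_sets[OF M.xi_star_measurable E] by (auto simp: sets_restrict_space_iff)
    \<comment> \<open>\<open>S\<close> is an involution, so images are preimages; this identifies
      the set function of \<open>mu_S_xi\<close> with the one for the reflected measure.\<close>
    moreover have "S ` X = S -` X" for X
      by (auto simp: S_def image_iff) (metis diff_diff_eq2 add_diff_cancel_left')
    moreover have "S \<in> borel_measurable (mu_star p q)" unfolding S_def by measurable
    ultimately show "emeasure (mu_star p q) (S ` xi_star_preimage E)
        = emeasure (distr (mu_star p q) borel S) (xi_star_preimage E)"
      by (simp add: emeasure_distr)
  qed
  then show "weak_gibbs 3 (mu_S_xi p q)" if "p \<le> q"
    using D.weak_gibbs_distr[OF that] by simp
qed

end
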